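(* Exact Bayesian Network Structure Learning is solvable in quadratic time (in the input size) on instances whose directed super-structure $S_f^{\rightarrow}$ is acyclic.
   Context: A dag is a directed acyclic graph; $\mathrm{P}_D(v)$ denotes the set of parents (in-neighbors) of $v$ in a digraph $D$. A local score function $f$ on a finite set $N$ of nodes assigns to each $v\in N$ and each $P\subseteq N\setminus\{v\}$ a non-negative real number $f(v,P)$. The score of a dag $D$ on node set $N$ is $f(D)=\sum_{v\in N} f(v,\mathrm{P}_D(v))$. Exact Bayesian Network Structure Learning is the decision problem: given a local score function $f$ on a set $N$ of nodes and a real number $s>0$, is there a dag $D$ on $N$ with $f(D)\ge s$? The function $f$ is given in the non-zero representation, i.e., as a list of all tuples $(v,P,f(v,P))$ with $f(v,P)>0$; the size of $f$ is the number of bits needed to represent this list. Let $\mathcal{P}_f(v)=\{P\subseteq N: f(v,P)>0\}\cup\{\emptyset\}$. The directed super-structure $S_f^{\rightarrow}$ of $f$ is the digraph on $N$ containing an arc $(u,v)$ if and only if $u\in P$ for some $P\in\mathcal{P}_f(v)$. *)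

theory Defs
  imports Complex_Main "HOL-Library.Log_Nat"
begin

section \<open>Random access machines with logarithmic cost\<close>

text \<open>
  The machine model is the random access machine of Cook and Reckhow (1973): no multiplication,
  logarithmic cost. Registers hold natural numbers (subtraction is truncated) and are initially 0;
  the input is a one-way read-only tape of bits. A program halts when the program counter leaves
  it, and accepts if register 0 is then nonzero.
\<close>

datatype instr =
    Const nat nat       \<comment> \<open>\<open>X\<^sub>i := c\<close>\<close>
  | Add nat nat nat     \<comment> \<open>\<open>X\<^sub>i := X\<^sub>j + X\<^sub>k\<close>\<close>
  | Sub nat nat nat     \<comment> \<open>\<open>X\<^sub>i := X\<^sub>j - X\<^sub>k\<close>\<close>
  | Load nat nat        \<comment> \<open>\<open>X\<^sub>i := X\<^bsub>X\<^sub>j\<^esub>\<close>\<close>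
  | Store nat nat       \<comment> \<open>\<open>X\<^bsub>X\<^sub>i\<^esub> := X\<^sub>j\<close>\<close>
  | JumpPos nat nat     \<comment> \<open>go to instruction \<open>m\<close> if \<open>X\<^sub>j > 0\<close>\<close>
  | Read nat            \<comment> \<open>\<open>X\<^sub>i :=\<close> next input bit\<close>

record config =
  pc :: nat
  reg :: "nat \<Rightarrow> nat"
  tape :: "bool list"

definition init_config :: "bool list \<Rightarrow> config" where
  "init_config w = \<lparr>pc = 0, reg = (\<lambda>_. 0), tape = w\<rparr>"

definition set_reg :: "nat \<Rightarrow> nat \<Rightarrow> config \<Rightarrow> config" where
  "set_reg i x c = c\<lparr>pc := Suc (pc c), reg := (reg c)(i := x)\<rparr>"

fun instr_step :: "instr \<Rightarrow> config \<Rightarrow> config" where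
  "instr_step (Const i n) c = set_reg i n c"
| "instr_step (Add i j k) c = set_reg i (reg c j + reg c k) c"
| "instr_step (Sub i j k) c = set_reg i (reg c j - reg c k) c"
| "instr_step (Load i j) c = set_reg i (reg c (reg c j)) c"
| "instr_step (Store i j) c = set_reg (reg c i) (reg c j) c"
| "instr_step (JumpPos j m) c = c\<lparr>pc := (if reg c j > 0 then m else Suc (pc c))\<rparr>"
| "instr_step (Read i) c =
     (set_reg i (case tape c of [] \<Rightarrow> 0 | b # _ \<Rightarrow> of_bool b) c)\<lparr>tape := tl (tape c)\<rparr>"

text \<open>\<^const>\<open>floorlog\<close> is the number of binary digits, except that it is 0 at 0.\<close>

definition num_size :: "nat \<Rightarrow> nat" where
  "num_size n = max 1 (floorlog 2 n)"

fun instr_cost :: "instr \<Rightarrow> config \<Rightarrow> nat" where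
  "instr_cost (Const i n) c = num_size n"
| "instr_cost (Add i j k) c = num_size (reg c j) + num_size (reg c k)"
| "instr_cost (Sub i j k) c = num_size (reg c j) + num_size (reg c k)"
| "instr_cost (Load i j) c = num_size (reg c j) + num_size (reg c (reg c j))"
| "instr_cost (Store i j) c = num_size (reg c i) + num_size (reg c j)"
| "instr_cost (JumpPos j m) c = num_size (reg c j)"
| "instr_cost (Read i) c = 1"

inductive exec :: "instr list \<Rightarrow> config \<Rightarrow> nat \<Rightarrow> config \<Rightarrow> bool" for M where
  refl: "exec M c 0 c"
| step: "pc c < length M \<Longrightarrow> exec M (instr_step (M ! pc c) c) t c' \<Longrightarrow>
         exec M c (instr_cost (M ! pc c) c + t) c'"

definition decides_within :: "instr list \<Rightarrow> bool list \<Rightarrow> nat \<Rightarrow> bool \<Rightarrow> bool" where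
  "decides_within M w T answer \<longleftrightarrow>
     (\<exists>t c. exec M (init_config w) t c \<and> length M \<le> pc c \<and> t \<le> T \<and> (reg c 0 > 0 \<longleftrightarrow> answer))"

text \<open>
  \<open>enc x w\<close> says that \<open>w\<close> is an encoding of the instance \<open>x\<close>; an instance may have several
  encodings. Inputs outside \<open>I\<close> are unconstrained.
\<close>

definition solvable_in_quadratic_time_on ::
  "'i set \<Rightarrow> ('i \<Rightarrow> bool list \<Rightarrow> bool) \<Rightarrow> ('i \<Rightarrow> bool) \<Rightarrow> bool" where
  "solvable_in_quadratic_time_on I enc yes \<longleftrightarrow>
     (\<exists>M k. \<forall>x\<in>I. \<forall>w. enc x w \<longrightarrow> decides_within M w (k * (length w)\<^sup>2) (yes x))"


section \<open>Exact Bayesian network structure learning\<close>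

text \<open>
  Nodes are natural numbers and a digraph is given by its set of arcs. A score function is only
  meaningful at \<open>(v, P)\<close> with \<open>v \<in> N\<close> and \<open>P \<subseteq> N - {v}\<close>; its other values are never used.
\<close>

type_synonym score = "nat \<Rightarrow> nat set \<Rightarrow> real"

definition local_score :: "nat set \<Rightarrow> score \<Rightarrow> bool" where
  "local_score N f \<longleftrightarrow> (\<forall>v\<in>N. \<forall>P. P \<subseteq> N - {v} \<longrightarrow> 0 \<le> f v P)"

definition dag_on :: "nat set \<Rightarrow> (nat \<times> nat) set \<Rightarrow> bool" where
  "dag_on N D \<longleftrightarrow> D \<subseteq> N \<times> N \<and> acyclic D"

definition parents :: "(nat \<times> nat) set \<Rightarrow> nat \<Rightarrow> nat set" where
  "parents D v = {u. (u, v) \<in> D}"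

definition dag_score :: "nat set \<Rightarrow> score \<Rightarrow> (nat \<times> nat) set \<Rightarrow> real" where
  "dag_score N f D = (\<Sum>v\<in>N. f v (parents D v))"

definition potential_parent_sets :: "nat set \<Rightarrow> score \<Rightarrow> nat \<Rightarrow> nat set set" where
  "potential_parent_sets N f v = {P. P \<subseteq> N - {v} \<and> f v P > 0} \<union> {{}}"

definition directed_super_structure :: "nat set \<Rightarrow> score \<Rightarrow> (nat \<times> nat) set" where
  "directed_super_structure N f =
     {(u, v). u \<in> N \<and> v \<in> N \<and> (\<exists>P\<in>potential_parent_sets N f v. u \<in> P)}"

type_synonym bnsl_instance = "nat set \<times> score \<times> real"

definition bnsl_instances :: "bnsl_instance set" where
  "bnsl_instances = {(N, f, s). finite N \<and> local_score N f \<and> s > 0}"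

fun bnsl_yes :: "bnsl_instance \<Rightarrow> bool" where
  "bnsl_yes (N, f, s) \<longleftrightarrow> (\<exists>D. dag_on N D \<and> dag_score N f D \<ge> s)"


section \<open>Encoding of instances\<close>

text \<open>Most significant digit first; 0 has no digits.\<close>

fun binary :: "nat \<Rightarrow> bool list" where
  "binary n = (if n = 0 then [] else binary (n div 2) @ [odd n])"

declare binary.simps [simp del]

text \<open>Self-delimiting: every element is preceded by the bit 1, and the list is followed by 0.\<close>

definition enc_list :: "('a \<Rightarrow> bool list) \<Rightarrow> 'a list \<Rightarrow> bool list" where
  "enc_list e xs = concat (map (\<lambda>x. True # e x) xs) @ [False]"

definition enc_nat :: "nat \<Rightarrow> bool list" where
  "enc_nat n = enc_list (\<lambda>b. [b]) (binary n)"

text \<open>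
  An entry \<open>(v, ps, p, q)\<close> stands for \<open>f v (set ps) = p / q\<close>. The fraction need not be in lowest
  terms. Only rational scores have a representation.
\<close>

type_synonym entry = "nat \<times> nat list \<times> nat \<times> nat"

fun enc_entry :: "entry \<Rightarrow> bool list" where
  "enc_entry (v, ps, p, q) = enc_nat v @ enc_list enc_nat ps @ enc_nat p @ enc_nat q"

definition nonzero_representation :: "nat set \<Rightarrow> score \<Rightarrow> entry list \<Rightarrow> bool" where
  "nonzero_representation N f es \<longleftrightarrow>
     distinct (map (\<lambda>(v, ps, p, q). (v, set ps)) es) \<and>
     (\<forall>(v, ps, p, q)\<in>set es. distinct ps \<and> q > 0) \<and>
     (\<lambda>(v, ps, p, q). (v, set ps, real p / real q)) ` set es =
       {(v, P, f v P) | v P. v \<in> N \<and> P \<subseteq> N - {v} \<and> f v P > 0}"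

fun encodes :: "bnsl_instance \<Rightarrow> bool list \<Rightarrow> bool" where
  "encodes (N, f, s) w \<longleftrightarrow>
     (\<exists>ns es p q. distinct ns \<and> set ns = N \<and> nonzero_representation N f es \<and>
        q > 0 \<and> s = real p / real q \<and>
        w = enc_list enc_nat ns @ enc_list enc_entry es @ enc_nat p @ enc_nat q)"

end

theory Submission
  imports Defs
begin

text \<open>
  If the directed super-structure is acyclic, every node may choose its parent set independently, so
  the optimum is the sum over the nodes of the largest listed score. A one-pass machine maintains
  this sum as a fraction \<open>P / Q\<close>, and for every node its best score \<open>p' / q'\<close> so far, in registers
  addressed by the node. An entry with \<open>D = p * q' - q * p' > 0\<close> replaces \<open>P / Q\<close> by
  \<open>P / Q + D / (q * q')\<close>. All registers stay below \<open>2 ^ O(n)\<close>, so it suffices that the number of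
  executed instructions is linear in \<open>n\<close>. Multiplication takes a number of instructions linear in
  the length of one factor. The length of \<open>q'\<close>, which may stem from a much longer earlier entry, is
  paid for by a potential (the total length of all stored \<open>q'\<close>), because \<open>q'\<close> is discarded; the same
  amortization keeps \<open>Q\<close> of linear length.
\<close>

section \<open>Structured programs with a step-counting calculus\<close>

text \<open>Quadratic time leaves room for only linearly many instructions, because operands of
  linear length make even one addition cost a linear amount. While an entry is processed, no loop
  may therefore run over the digits of \<open>P\<close> or \<open>Q\<close>: every product is
  arranged so that its loop scans a short factor. Keeping the total up to date spares a second
  traversal of the nodes, whose names have long left the one-way tape when the last entry is read.
  Fractions are never reduced, so \<open>Q\<close> is a plain product of denominators. A denominator
  enters it at most twice, when its entry is accepted and when it is replaced; this is what keeps
  the length of \<open>Q\<close> linear. The numerator is controlled separately, through the value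
  of \<open>P / Q\<close>, which grows by at most \<open>p\<close> with each accepted entry.\<close>

text \<open>
  \<open>IfZ r c\<close> runs \<open>c\<close> if register \<open>r\<close> is zero; \<open>Rep c r\<close> runs \<open>c\<close> until register \<open>r\<close> is zero,
  and at least once. These two need no unconditional jump, which the machine lacks.
\<close>

datatype com = Atom instr | Seq com com (infixr ";;" 60) | IfZ nat com | Rep com nat

fun code_size :: "com \<Rightarrow> nat" where
  "code_size (Atom i) = 1"
| "code_size (a ;; b) = code_size a + code_size b"
| "code_size (IfZ r a) = Suc (code_size a)"
| "code_size (Rep a r) = Suc (code_size a)"

fun compile :: "nat \<Rightarrow> com \<Rightarrow> instr list" where
  "compile n (Atom i) = [i]"
| "compile n (a ;; b) = compile n a @ compile (n + code_size a) b"
| "compile n (IfZ r a) = JumpPos r (Suc n + code_size a) # compile (Suc n) a"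
| "compile n (Rep a r) = compile n a @ [JumpPos r n]"

lemma length_compile [simp]: "length (compile n c) = code_size c"
  by (induction c arbitrary: n) auto

fun is_jump :: "instr \<Rightarrow> bool" where
  "is_jump (JumpPos j m) = True"
| "is_jump _ = False"

text \<open>
  In \<open>run B c R w k R' w'\<close>, \<open>B\<close> bounds the cost of each single instruction, \<open>k\<close> counts instructions.
\<close>

inductive run :: "nat \<Rightarrow> com \<Rightarrow> (nat \<Rightarrow> nat) \<Rightarrow> bool list \<Rightarrow> nat \<Rightarrow> (nat \<Rightarrow> nat) \<Rightarrow> bool list \<Rightarrow> bool"
  for B where
  run_Atom: "\<not> is_jump i \<Longrightarrow> instr_cost i \<lparr>pc = 0, reg = R, tape = w\<rparr> \<le> B \<Longrightarrow>
    instr_step i \<lparr>pc = 0, reg = R, tape = w\<rparr> = \<lparr>pc = n, reg = R', tape = w'\<rparr> \<Longrightarrow>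
    run B (Atom i) R w 1 R' w'"
| run_Seq: "run B a R w k R' w' \<Longrightarrow> run B b R' w' l R'' w'' \<Longrightarrow> run B (a ;; b) R w (k + l) R'' w''"
| run_IfZ_pos: "R r > 0 \<Longrightarrow> num_size (R r) \<le> B \<Longrightarrow> run B (IfZ r a) R w 1 R w"
| run_IfZ_zero: "R r = 0 \<Longrightarrow> num_size (R r) \<le> B \<Longrightarrow> run B a R w k R' w' \<Longrightarrow>
    run B (IfZ r a) R w (Suc k) R' w'"
| run_Rep_stop: "run B a R w k R' w' \<Longrightarrow> R' r = 0 \<Longrightarrow> num_size (R' r) \<le> B \<Longrightarrow>
    run B (Rep a r) R w (Suc k) R' w'"
| run_Rep_again: "run B a R w k R' w' \<Longrightarrow> R' r > 0 \<Longrightarrow> num_size (R' r) \<le> B \<Longrightarrow>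
    run B (Rep a r) R' w' l R'' w'' \<Longrightarrow> run B (Rep a r) R w (Suc (k + l)) R'' w''"

section \<open>Correctness and cost of compilation\<close>

lemma exec_trans: "exec M c t c' \<Longrightarrow> exec M c' t' c'' \<Longrightarrow> exec M c (t + t') c''"
  by (induction rule: exec.induct) (auto simp: add.assoc intro: exec.step)

lemma exec_single:
  assumes "pc c < length M"
  shows "exec M c (instr_cost (M ! pc c) c) (instr_step (M ! pc c) c)"
  using exec.step[OF assms exec.refl] by simp

text \<open>\<open>run\<close> evaluates an atom at program counter 0. Together with the next lemma
  this moves the atom to the address where the compiler puts it.\<close>

lemma instr_cost_pc: "instr_cost i \<lparr>pc = m, reg = R, tape = w\<rparr> = instr_cost i \<lparr>pc = n, reg = R, tape = w\<rparr>"
  by (cases i) auto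

lemma instr_step_pc:
  assumes "\<not> is_jump i" "instr_step i \<lparr>pc = 0, reg = R, tape = w\<rparr> = \<lparr>pc = n, reg = R', tape = w'\<rparr>"
  shows "instr_step i \<lparr>pc = m, reg = R, tape = w\<rparr> = \<lparr>pc = Suc m, reg = R', tape = w'\<rparr>"
  using assms by (cases i) (auto simp: set_reg_def)

text \<open>Jump targets are absolute, so the code is placed between arbitrary \<open>pre\<close>
  and \<open>post\<close> with load address \<open>length pre\<close>. The induction hypotheses then
  apply to subprograms in their actual position.\<close>

lemma exec_compile:
  assumes "run B c R w k R' w'"
  shows "\<exists>t \<le> k * B. exec (pre @ compile (length pre) c @ post) \<lparr>pc = length pre, reg = R, tape = w\<rparr> t
    \<lparr>pc = length pre + code_size c, reg = R', tape = w'\<rparr>"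
  using assms
proof (induction arbitrary: pre post rule: run.induct)
  case (run_Atom i R w n R' w')
  then show ?case
    using exec_single[of "\<lparr>pc = length pre, reg = R, tape = w\<rparr>" "pre @ compile (length pre) (Atom i) @ post"]
      instr_step_pc[OF run_Atom(1,3), of "length pre"] instr_cost_pc[of i "length pre" R w 0]
    by (auto simp: nth_append)
next
  case (run_Seq a R w k R' w' b l R'' w'')
  obtain t where t: "t \<le> k * B"
    "exec (pre @ compile (length pre) (a ;; b) @ post) \<lparr>pc = length pre, reg = R, tape = w\<rparr> t
      \<lparr>pc = length pre + code_size a, reg = R', tape = w'\<rparr>"
    using run_Seq.IH(1)[of pre "compile (length pre + code_size a) b @ post"] by auto
  obtain u where u: "u \<le> l * B"
    "exec (pre @ compile (length pre) (a ;; b) @ post)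
      \<lparr>pc = length pre + code_size a, reg = R', tape = w'\<rparr> u
      \<lparr>pc = length pre + code_size (a ;; b), reg = R'', tape = w''\<rparr>"
    using run_Seq.IH(2)[of "pre @ compile (length pre) a" post] by (auto simp: add.assoc)
  show ?case
    using exec_trans[OF t(2) u(2)] t(1) u(1) by (intro exI[of _ "t + u"]) (simp add: algebra_simps)
next
  case (run_IfZ_pos R r a w)
  then show ?case
    using exec_single[of "\<lparr>pc = length pre, reg = R, tape = w\<rparr>" "pre @ compile (length pre) (IfZ r a) @ post"]
    by (auto simp: nth_append)
next
  case (run_IfZ_zero R r a w k R' w')
  obtain t where t: "t \<le> k * B"
    "exec (pre @ compile (length pre) (IfZ r a) @ post) \<lparr>pc = Suc (length pre), reg = R, tape = w\<rparr> t
      \<lparr>pc = length pre + code_size (IfZ r a), reg = R', tape = w'\<rparr>"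
    using run_IfZ_zero.IH[of "pre @ [JumpPos r (Suc (length pre) + code_size a)]" post] by auto
  have "exec (pre @ compile (length pre) (IfZ r a) @ post) \<lparr>pc = length pre, reg = R, tape = w\<rparr> (num_size (R r))
      \<lparr>pc = Suc (length pre), reg = R, tape = w\<rparr>"
    using exec_single[of "\<lparr>pc = length pre, reg = R, tape = w\<rparr>" "pre @ compile (length pre) (IfZ r a) @ post"]
      run_IfZ_zero.hyps by (simp add: nth_append)
  from exec_trans[OF this t(2)] show ?case
    using t(1) run_IfZ_zero.hyps by (intro exI[of _ "num_size (R r) + t"]) simp
next
  case (run_Rep_stop a R w k R' w' r)
  obtain t where t: "t \<le> k * B"
    "exec (pre @ compile (length pre) (Rep a r) @ post) \<lparr>pc = length pre, reg = R, tape = w\<rparr> t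
      \<lparr>pc = length pre + code_size a, reg = R', tape = w'\<rparr>"
    using run_Rep_stop.IH[of pre "JumpPos r (length pre) # post"] by auto
  have "exec (pre @ compile (length pre) (Rep a r) @ post)
      \<lparr>pc = length pre + code_size a, reg = R', tape = w'\<rparr> (num_size (R' r))
      \<lparr>pc = length pre + code_size (Rep a r), reg = R', tape = w'\<rparr>"
    using exec_single[of "\<lparr>pc = length pre + code_size a, reg = R', tape = w'\<rparr>"
        "pre @ compile (length pre) (Rep a r) @ post"] run_Rep_stop.hyps
    by (simp add: nth_append)
  from exec_trans[OF t(2) this] show ?case
    using t(1) run_Rep_stop.hyps by (intro exI[of _ "t + num_size (R' r)"]) simp
next
  case (run_Rep_again a R w k R' w' r l R'' w'')
  obtain t where t: "t \<le> k * B"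
    "exec (pre @ compile (length pre) (Rep a r) @ post) \<lparr>pc = length pre, reg = R, tape = w\<rparr> t
      \<lparr>pc = length pre + code_size a, reg = R', tape = w'\<rparr>"
    using run_Rep_again.IH(1)[of pre "JumpPos r (length pre) # post"] by auto
  obtain u where u: "u \<le> l * B"
    "exec (pre @ compile (length pre) (Rep a r) @ post) \<lparr>pc = length pre, reg = R', tape = w'\<rparr> u
      \<lparr>pc = length pre + code_size (Rep a r), reg = R'', tape = w''\<rparr>"
    using run_Rep_again.IH(2)[of pre post] by auto
  have "exec (pre @ compile (length pre) (Rep a r) @ post)
      \<lparr>pc = length pre + code_size a, reg = R', tape = w'\<rparr> (num_size (R' r))
      \<lparr>pc = length pre, reg = R', tape = w'\<rparr>"
    using exec_single[of "\<lparr>pc = length pre + code_size a, reg = R', tape = w'\<rparr>"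
        "pre @ compile (length pre) (Rep a r) @ post"] run_Rep_again.hyps
    by (simp add: nth_append)
  from exec_trans[OF t(2) exec_trans[OF this u(2)]] show ?case
    using t(1) u(1) run_Rep_again.hyps
    by (intro exI[of _ "t + (num_size (R' r) + u)"]) (simp add: algebra_simps)
qed

text \<open>The factor 2 is there because an instruction has at most two operands.\<close>

definition wp :: "nat \<Rightarrow> com \<Rightarrow> (nat \<Rightarrow> (nat \<Rightarrow> nat) \<Rightarrow> bool list \<Rightarrow> bool) \<Rightarrow> (nat \<Rightarrow> nat) \<Rightarrow> bool list \<Rightarrow> bool" where
  "wp b c Q R w \<longleftrightarrow> (\<exists>k R' w'. run (2 * b) c R w k R' w' \<and> Q k R' w')"

section \<open>Rules for preconditions that count instructions\<close>

lemma wp_conseq: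
  "wp b c Q R w \<Longrightarrow> (\<And>k R' w'. Q k R' w' \<Longrightarrow> Q' k R' w') \<Longrightarrow> wp b c Q' R w"
  unfolding wp_def by blast

lemma num_size_le: "x < 2 ^ b \<Longrightarrow> 1 \<le> b \<Longrightarrow> num_size x \<le> b"
  by (cases "x = 0") (auto simp: num_size_def floorlog_le_iff)

lemma num_size_le2: "x < 2 ^ b \<Longrightarrow> 1 \<le> b \<Longrightarrow> num_size x \<le> 2 * b"
  using num_size_le[of x b] by simp

lemma wp_Atom:
  assumes "\<not> is_jump i" "instr_cost i \<lparr>pc = 0, reg = R, tape = w\<rparr> \<le> 2 * b"
    "instr_step i \<lparr>pc = 0, reg = R, tape = w\<rparr> = \<lparr>pc = n, reg = R', tape = w'\<rparr>" "Q 1 R' w'"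
  shows "wp b (Atom i) Q R w"
  using run_Atom[OF assms(1-3)] assms(4) unfolding wp_def by blast

lemma wp_Seq:
  "wp b c (\<lambda>k. wp b d (\<lambda>l. Q (k + l))) R w \<Longrightarrow> wp b (c ;; d) Q R w"
  unfolding wp_def by (blast intro: run_Seq)

lemma wp_Seq_conseq:
  "wp b c P R w \<Longrightarrow> (\<And>k R' w'. P k R' w' \<Longrightarrow> wp b d (\<lambda>l. Q (k + l)) R' w') \<Longrightarrow> wp b (c ;; d) Q R w"
  by (rule wp_Seq) (rule wp_conseq)

lemma wp_Const:
  "1 \<le> b \<Longrightarrow> n < 2 ^ b \<Longrightarrow> Q 1 (R(i := n)) w \<Longrightarrow> wp b (Atom (Const i n)) Q R w"
  by (rule wp_Atom) (simp_all add: set_reg_def num_size_le2)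

lemma wp_Add:
  "1 \<le> b \<Longrightarrow> R j < 2 ^ b \<Longrightarrow> R l < 2 ^ b \<Longrightarrow> Q 1 (R(i := R j + R l)) w \<Longrightarrow>
    wp b (Atom (Add i j l)) Q R w"
  using num_size_le[of "R j" b] num_size_le[of "R l" b]
  by (intro wp_Atom) (simp_all add: set_reg_def)

lemma wp_Sub:
  "1 \<le> b \<Longrightarrow> R j < 2 ^ b \<Longrightarrow> R l < 2 ^ b \<Longrightarrow> Q 1 (R(i := R j - R l)) w \<Longrightarrow>
    wp b (Atom (Sub i j l)) Q R w"
  using num_size_le[of "R j" b] num_size_le[of "R l" b]
  by (intro wp_Atom) (simp_all add: set_reg_def)

lemma wp_Load:
  "1 \<le> b \<Longrightarrow> R j < 2 ^ b \<Longrightarrow> R (R j) < 2 ^ b \<Longrightarrow> Q 1 (R(i := R (R j))) w \<Longrightarrow>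
    wp b (Atom (Load i j)) Q R w"
  using num_size_le[of "R j" b] num_size_le[of "R (R j)" b]
  by (intro wp_Atom) (simp_all add: set_reg_def)

lemma wp_Store:
  "1 \<le> b \<Longrightarrow> R i < 2 ^ b \<Longrightarrow> R j < 2 ^ b \<Longrightarrow> Q 1 (R(R i := R j)) w \<Longrightarrow>
    wp b (Atom (Store i j)) Q R w"
  using num_size_le[of "R j" b] num_size_le[of "R i" b]
  by (intro wp_Atom) (simp_all add: set_reg_def)

lemma wp_Read:
  "1 \<le> b \<Longrightarrow> Q 1 (R(i := of_bool x)) w \<Longrightarrow> wp b (Atom (Read i)) Q R (x # w)"
  by (rule wp_Atom) (simp_all add: set_reg_def)

lemma wp_IfZ:
  assumes "1 \<le> b" "R r < 2 ^ b" "R r > 0 \<Longrightarrow> Q 1 R w"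
    "R r = 0 \<Longrightarrow> wp b c (\<lambda>k. Q (Suc k)) R w"
  shows "wp b (IfZ r c) Q R w"
proof (cases "R r = 0")
  case True
  then show ?thesis
    using assms(4) num_size_le2[OF assms(2,1)] run_IfZ_zero unfolding wp_def by blast
next
  case False
  then show ?thesis
    using assms(3) num_size_le2[OF assms(2,1)] run_IfZ_pos unfolding wp_def by blast
qed

text \<open>Only one round is unfolded. Each loop brings its own induction, which also yields
  termination, since \<open>wp\<close> asserts that a finite run exists.\<close>

lemma wp_Rep:
  assumes "wp b c (\<lambda>k R' w'. R' r < 2 ^ b \<and> (if R' r = 0 then Q (Suc k) R' w'
     else wp b (Rep c r) (\<lambda>l. Q (Suc (k + l))) R' w')) R w" "1 \<le> b"
  shows "wp b (Rep c r) Q R w"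
proof -
  obtain k R' w' where *: "run (2 * b) c R w k R' w'" "R' r < 2 ^ b"
    "if R' r = 0 then Q (Suc k) R' w' else wp b (Rep c r) (\<lambda>l. Q (Suc (k + l))) R' w'"
    using assms(1) unfolding wp_def by blast
  note size = num_size_le2[OF *(2) assms(2)]
  show ?thesis
  proof (cases "R' r = 0")
    case True
    then show ?thesis
      using * run_Rep_stop[OF *(1) True size] unfolding wp_def by auto
  next
    case False
    then show ?thesis
      using *(3) run_Rep_again[OF *(1) _ size] unfolding wp_def by auto blast
  qed
qed

section \<open>Reading self-delimiting numbers and lists\<close>

text \<open>
  Register layout. 0: answer; 2 and 3: the constants 0 and 1; 4 to 6: scratch and the loop flag
  of \<open>read_nat\<close>; 7 to 11: scratch for \<open>mul\<close>; 12 and 13: outer loop flags; 14 to 17: the fields of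
  the current entry; 18 and 19: \<open>p'\<close> and \<open>q'\<close>; 20 to 23: intermediate products; 24 and 25: \<open>P\<close> and
  \<open>Q\<close>; 26 and 27: addresses. Above 30 three arrays are interleaved: powers of two at \<open>3 * i + 30\<close>,
  and the best score of node \<open>v\<close> at \<open>3 * v + 31\<close> and \<open>3 * v + 32\<close>. A denominator 0 there means
  that no entry of \<open>v\<close> has been read.
\<close>

definition enc_loop :: "nat \<Rightarrow> com \<Rightarrow> com" where
  "enc_loop t c = Rep (Atom (Read t) ;; Atom (Sub 4 3 t) ;; IfZ 4 c) t"

text \<open>\<open>I\<close> describes the state after the elements read so far,
  \<open>\<phi>\<close> is a potential, and \<open>g x\<close> is the amortized cost of an element;
  constant \<open>\<phi>\<close> gives a plain count. Register \<open>t\<close> holds the marker bit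
  and also decides on repetition, so the body must leave it at 1. The 4 counts the read, the
  negation and the two jumps of a round; the last round, which reads the closing 0, costs the
  same.\<close>

lemma wp_enc_loop:
  fixes \<phi> :: "(nat \<Rightarrow> nat) \<Rightarrow> nat"
  assumes b: "1 \<le> b" and t: "t \<noteq> 3" "t \<noteq> 4"
    and init: "I [] R"
    and one: "\<And>ys R. I ys R \<Longrightarrow> R 3 = 1"
    and upd: "\<And>ys R u v. I ys R \<Longrightarrow> I ys (R(t := u, 4 := v))"
    and \<phi>_upd: "\<And>R u v. \<phi> (R(t := u, 4 := v)) = \<phi> R"
    and body: "\<And>ys x zs R w. xs = ys @ x # zs \<Longrightarrow> I ys R \<Longrightarrow> R t = 1 \<Longrightarrow>
      wp b c (\<lambda>k R' w'. w' = w \<and> R' t = 1 \<and> I (ys @ [x]) R' \<and> k + \<phi> R' \<le> \<phi> R + g x) R (e x @ w)"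
  shows "wp b (enc_loop t c) (\<lambda>k R' w'. w' = w \<and> I xs R' \<and>
    k + \<phi> R' \<le> \<phi> R + (\<Sum>x\<leftarrow>xs. g x + 4) + 4) R (enc_list e xs @ w)"
proof -
  have pow: "(1::nat) < 2 ^ b"
    using b by (intro one_less_power) auto
  have "wp b (enc_loop t c) (\<lambda>k R' w'. w' = w \<and> I xs R' \<and>
      k + \<phi> R' \<le> \<phi> R + (\<Sum>x\<leftarrow>zs. g x + 4) + 4) R (enc_list e zs @ w)"
    if "xs = ys @ zs" "I ys R" for ys zs R
    using that
  proof (induction zs arbitrary: ys R)
    case Nil
    then have "R 3 = 1" "I ys (R(t := 0, 4 := 1))"
      using one upd by auto
    with Nil show ?case
      unfolding enc_loop_def enc_list_def
      using b pow by (auto intro!: wp_Rep wp_Seq wp_Read wp_Sub wp_IfZ simp: t \<phi>_upd)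
  next
    case (Cons x zs)
    let ?R = "R(t := 1, 4 := 0)"
    have R: "R 3 = 1" "I ys ?R" "?R t = 1"
      using Cons.prems one upd t by auto
    have IH: "wp b (enc_loop t c) (\<lambda>k R'' w'. w' = w \<and> I xs R'' \<and>
        k + \<phi> R'' \<le> \<phi> R' + (\<Sum>x\<leftarrow>zs. g x + 4) + 4) R' (enc_list e zs @ w)"
      if "I (ys @ [x]) R'" for R'
      using Cons.IH[OF _ that] Cons.prems by simp
    have enc: "enc_list e (x # zs) @ w = True # e x @ (enc_list e zs @ w)"
      by (simp add: enc_list_def)
    show ?case
      unfolding enc_loop_def enc
      apply (rule wp_Rep[OF _ b], rule wp_Seq, rule wp_Read[OF b], rule wp_Seq, rule wp_Sub[OF b])
         apply (use pow in \<open>simp_all add: R t\<close>)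
      apply (rule wp_IfZ[OF b])
        apply (simp_all add: R t)
      apply (rule wp_conseq[OF body[OF Cons.prems(1) R(2,3), unfolded \<phi>_upd One_nat_def]])
      apply (use pow in clarsimp)
      apply (rule wp_conseq[OF IH[unfolded enc_loop_def]])
       apply (auto simp: \<phi>_upd)
      done
  qed
  from this[of "[]" xs R] init show ?thesis
    by simp
qed

definition bits_value :: "bool list \<Rightarrow> nat" where
  "bits_value = foldl (\<lambda>a c. 2 * a + of_bool c) 0"

lemma bits_value_simps [simp]:
  "bits_value [] = 0" "bits_value (xs @ [c]) = 2 * bits_value xs + of_bool c"
  by (simp_all add: bits_value_def)

text \<open>Prefix values never exceed the final number, which bounds the register while its digits
  are still being read.\<close>

lemma bits_value_append: "bits_value xs \<le> bits_value (xs @ ys)"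
  by (induction ys rule: rev_induct) (auto simp flip: append_assoc)

lemma bits_value_binary: "bits_value (binary n) = n"
  by (induction n rule: binary.induct) (subst binary.simps, auto)

lemma length_binary: "length (binary n) = floorlog 2 n"
  by (induction n rule: binary.induct) (subst binary.simps, subst compute_floorlog, auto)

lemma length_enc_nat: "length (enc_nat n) = 2 * floorlog 2 n + 1"
  by (simp add: enc_nat_def enc_list_def length_concat comp_def sum_list_triv length_binary)

definition read_nat :: "nat \<Rightarrow> com" where
  "read_nat x = Atom (Const x 0) ;;
     enc_loop 5 (Atom (Read 6) ;; Atom (Add x x x) ;; Atom (Add x x 6))"

text \<open>A digit occupies two bits and takes 3 + 4 instructions, and 5 more are spent outside the
  digits. With \<open>d\<close> digits, \<open>7 * d + 5\<close> is at most
  \<open>5 * (2 * d + 1)\<close>.\<close>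

lemma wp_read_nat:
  assumes b: "1 \<le> b" and x: "x \<notin> {3, 4, 5, 6}" and n: "n < 2 ^ b" and one: "R 3 = 1"
  shows "wp b (read_nat x) (\<lambda>k R' w'. w' = w \<and> R' x = n \<and> (\<forall>r. r \<notin> {x, 4, 5, 6} \<longrightarrow> R' r = R r) \<and>
    k \<le> 5 * length (enc_nat n)) R (enc_nat n @ w)"
proof -
  define I where "I ys R' \<longleftrightarrow> R' x = bits_value ys \<and> (\<forall>r. r \<notin> {x, 4, 5, 6} \<longrightarrow> R' r = R r)"
    for ys and R' :: "nat \<Rightarrow> nat"
  have pow: "(1::nat) < 2 ^ b"
    using b by (intro one_less_power) auto
  have "wp b (Atom (Read 6) ;; Atom (Add x x x) ;; Atom (Add x x 6))
     (\<lambda>k R'' w'. w' = w \<and> R'' 5 = 1 \<and> I (ys @ [c]) R'' \<and> k + (\<lambda>_. 0) R'' \<le> (\<lambda>_. 0) R' + 3) R' ([c] @ w)"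
    if "binary n = ys @ c # zs" "I ys R'" "R' 5 = 1" for ys c zs R' w
  proof -
    have "bits_value (ys @ [c]) \<le> n"
      using bits_value_append[of "ys @ [c]" zs] bits_value_binary[of n] that(1) by simp
    then have bound: "2 * bits_value ys + of_bool c < 2 ^ b"
      using n by simp
    then have bound': "2 * bits_value ys < 2 ^ b" "bits_value ys < 2 ^ b"
      by linarith+
    have "(of_bool c :: nat) < 2 ^ b"
      using pow by simp
    then show ?thesis
      using bound bound' that(2,3) x b unfolding append_Cons append_Nil
      by (intro wp_Seq wp_Read wp_Add) (auto simp: I_def)
  qed
  then have "wp b (enc_loop 5 (Atom (Read 6) ;; Atom (Add x x x) ;; Atom (Add x x 6)))
     (\<lambda>k R' w'. w' = w \<and> I (binary n) R' \<and> k + (\<lambda>_. 0) R' \<le> (\<lambda>_. 0) (R(x := 0)) + (\<Sum>x\<leftarrow>binary n. 3 + 4) + 4)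
     (R(x := 0)) (enc_list (\<lambda>c. [c]) (binary n) @ w)"
    using x one by (intro wp_enc_loop b) (auto simp: I_def)
  then show ?thesis
    unfolding read_nat_def enc_nat_def[symmetric]
    using b x
    by (intro wp_Seq wp_Const) (auto simp: I_def bits_value_binary sum_list_triv length_binary length_enc_nat
        elim!: wp_conseq)
qed

section \<open>Multiplication\<close>

definition table_address :: "nat \<Rightarrow> bool" where
  "table_address r \<longleftrightarrow> 30 \<le> r \<and> r mod 3 = 0"

text \<open>\<open>S\<close> lists the registers that may change. The power table is exempt
  throughout, since every multiplication refills it up to an index that depends on the
  factor.\<close>

definition agree :: "nat set \<Rightarrow> (nat \<Rightarrow> nat) \<Rightarrow> (nat \<Rightarrow> nat) \<Rightarrow> bool" where
  "agree S R R' \<longleftrightarrow> (\<forall>r. r \<notin> S \<and> \<not> table_address r \<longrightarrow> R' r = R r)"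

definition table_addr :: com where
  "table_addr = Atom (Add 11 9 9) ;; Atom (Add 11 11 9) ;; Atom (Const 4 30) ;; Atom (Add 11 11 4)"

text \<open>Subtraction truncates, so the test value \<open>X + 1 - 2 ^ (i + 1)\<close> is positive
  exactly if the next power is still at most \<open>X\<close>; hence the added 1.\<close>

definition fill_body :: com where
  "fill_body = table_addr ;; Atom (Store 11 10) ;; Atom (Add 10 10 10) ;;
     Atom (Add 9 9 3) ;; Atom (Add 4 7 3) ;; Atom (Sub 4 4 10)"

text \<open>The truncated difference of \<open>2 ^ i\<close> and the remainder vanishes exactly if
  the next digit is 1, which is when \<open>IfZ\<close> enters its branch.\<close>

definition mul_body :: "nat \<Rightarrow> com" where
  "mul_body y = Atom (Sub 9 9 3) ;; table_addr ;; Atom (Load 10 11) ;;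
     Atom (Add 8 8 8) ;; Atom (Sub 4 10 7) ;; IfZ 4 (Atom (Sub 7 7 10) ;; Atom (Add 8 8 y))"

text \<open>
  The machine cannot halve, so the powers of two up to the first factor are tabulated, and then
  subtracted from it in descending order, which yields its digits for a Horner scheme.
\<close>

definition mul_loops :: "nat \<Rightarrow> nat \<Rightarrow> com" where
  "mul_loops d y = Rep fill_body 4 ;; Rep (mul_body y) 9 ;; Atom (Add d 8 2)"

text \<open>The product accumulates in scratch registers and reaches \<open>d\<close> only at the
  end, so \<open>d\<close> may coincide with a factor, as it does when \<open>Q\<close> is
  updated.\<close>

definition mul :: "nat \<Rightarrow> nat \<Rightarrow> nat \<Rightarrow> com" where
  "mul d x y = Atom (Add 7 x 2) ;; Atom (Const 8 0) ;; Atom (Const 9 0) ;; Atom (Const 10 1) ;;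
     mul_loops d y"

lemma wp_table_addr:
  assumes "1 \<le> b" "3 * R 9 + 30 < 2 ^ b"
    "Q 4 (R(11 := 3 * R 9 + 30, 4 := 30)) w"
  shows "wp b table_addr Q R w"
proof -
  have "R(11 := 3 * R 9 + 30, 4 := 30) =
     R(11 := R 9 + R 9, 11 := R 9 + R 9 + R 9, 4 := 30, 11 := R 9 + R 9 + R 9 + 30)"
    by (auto simp: fun_eq_iff)
  then show ?thesis
    using assms unfolding table_addr_def
    by (intro wp_Seq wp_Add wp_Const) (auto simp: numeral_eq_Suc)
qed

text \<open>\<open>Rep\<close> runs at least once, so the power 1 is tabulated even for
  \<open>X = 0\<close>. This is why the hypothesis reads \<open>X + 1\<close> and why
  \<open>m\<close> may exceed the number of digits by one.\<close>

lemma wp_fill: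
  assumes b: "8 \<le> b" and X: "X < 2 ^ (b - 2)"
    and R: "R 7 = X" "R 3 = 1" "R 9 = i" "R 10 = 2 ^ i" "\<And>j. j < i \<Longrightarrow> R (3 * j + 30) = 2 ^ j"
    and i: "2 ^ i \<le> X + 1"
  shows "wp b (Rep fill_body 4) (\<lambda>k R' w'. w' = w \<and> agree {4, 9, 10, 11} R R' \<and>
     (\<exists>m. R' 9 = m \<and> i < m \<and> X < 2 ^ m \<and> m \<le> floorlog 2 X + 1 \<and>
       (\<forall>j<m. R' (3 * j + 30) = 2 ^ j) \<and> k + 10 * i \<le> 10 * m)) R w"
  using R i
proof (induction "X - i" arbitrary: i R rule: less_induct)
  case less
  have fl: "X < 2 ^ floorlog 2 X"
    using floorlog_le_iff[of 2 X "floorlog 2 X"] by simp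
  then have "2 ^ i \<le> (2::nat) ^ floorlog 2 X"
    using less.prems(6) by linarith
  then have i: "i \<le> floorlog 2 X"
    by (simp add: power_increasing_iff)
  have "floorlog 2 X \<le> b"
    using X order_less_le_trans[OF X, of "2 ^ b"] by (simp add: floorlog_le_iff)
  moreover have "3 * b + 30 < 2 ^ b"
    using b by (induction b rule: dec_induct) auto
  ultimately have addr: "3 * i + 30 < 2 ^ b"
    using i by linarith
  \<comment> \<open>The two spare bits absorb the last doubling, as
    \<open>2 * 2 ^ i \<le> 2 * X + 2\<close>.\<close>
  have b2: "4 * X < 2 ^ b" "4 < (2::nat) ^ b"
  proof -
    have "2 + (b - 2) = b"
      using b by simp
    then have "(2::nat) ^ b = 2 ^ 2 * 2 ^ (b - 2)"
      using power_add[of "2::nat" 2 "b - 2"] by (simp only:)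
    then show "4 * X < 2 ^ b"
      using X by simp
    show "4 < (2::nat) ^ b"
      using power_strict_increasing[of 2 b "2::nat"] b by simp
  qed
  have bounds: "2 ^ i < (2::nat) ^ b" "2 * 2 ^ i < (2::nat) ^ b" "i < 2 ^ b" "Suc X < 2 ^ b" "X < 2 ^ b"
    using less.prems(6) b2 addr by linarith+
  define R' where "R' = R(11 := 3 * i + 30, 3 * i + 30 := 2 ^ i, 10 := 2 * 2 ^ i, 9 := Suc i,
    4 := Suc X - 2 * 2 ^ i)"
  have R'_simps: "R' 7 = X" "R' 3 = 1" "R' 9 = Suc i" "R' 10 = 2 ^ Suc i" "R' 4 = Suc X - 2 * 2 ^ i"
     "agree {4, 9, 10, 11} R R'" "\<And>j. j < Suc i \<Longrightarrow> R' (3 * j + 30) = 2 ^ j"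
    using less.prems by (auto simp: R'_def agree_def table_address_def less_Suc_eq mod_add_eq)
  have upd: "R(11 := 3 * i + 30, 4 := 30, 3 * i + 30 := 2 ^ i, 10 := 2 ^ i + 2 ^ i, 9 := Suc i,
      4 := Suc X, 4 := Suc X - (2 ^ i + 2 ^ i)) = R'"
    by (auto simp: R'_def fun_eq_iff)
  have "wp b fill_body (\<lambda>k R'' w'. k = 9 \<and> w' = w \<and> R'' = R') R w"
    unfolding fill_body_def using less.prems b bounds addr upd
    by (intro wp_Seq wp_table_addr wp_Add wp_Sub wp_Store) (auto simp: mult_2)
  moreover have "R' 4 < 2 ^ b"
    using bounds(4) unfolding R'_simps by linarith
  moreover have "wp b (Rep fill_body 4) (\<lambda>l R'' w'. w' = w \<and> agree {4, 9, 10, 11} R R'' \<and>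
     (\<exists>m. R'' 9 = m \<and> i < m \<and> X < 2 ^ m \<and> m \<le> floorlog 2 X + 1 \<and>
       (\<forall>j<m. R'' (3 * j + 30) = 2 ^ j) \<and> Suc (9 + l) + 10 * i \<le> 10 * m)) R' w" if "R' 4 \<noteq> 0"
  proof -
    have le: "2 ^ Suc i \<le> X"
      using that unfolding R'_simps by simp
    moreover have "i < 2 ^ Suc i"
      using less_exp[of "Suc i"] by linarith
    ultimately have "X - Suc i < X - i"
      by linarith
    from less.hyps[OF this R'_simps(1-4,7)] le show ?thesis
      using R'_simps(6) by (auto elim!: wp_conseq simp: agree_def)
  qed
  moreover have "X < 2 ^ Suc i" if "R' 4 = 0"
    using that unfolding R'_simps by simp
  ultimately show ?case
    using b i R'_simps by (intro wp_Rep) (auto elim!: wp_conseq)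
qed

text \<open>The quantity \<open>R 8 * 2 ^ i + x * R y\<close> is invariant: the Horner accumulator
  is still to be shifted by \<open>i\<close> digits, and \<open>x\<close> holds those digits. Being
  below \<open>2 ^ b\<close>, it bounds the accumulator as well.\<close>

lemma wp_mul_loop:
  assumes b: "8 \<le> b" and y: "y \<notin> {4, 7, 8, 9, 10, 11}" "\<not> table_address y"
    and R: "R 9 = i" "0 < i" "R 7 = x" "x < 2 ^ i" "R 8 * 2 ^ i + x * R y < 2 ^ b" "R 3 = 1" "R y < 2 ^ b"
      "\<And>j. j < i \<Longrightarrow> R (3 * j + 30) = 2 ^ j"
    and i: "i \<le> b - 1"
  shows "wp b (Rep (mul_body y) 9) (\<lambda>k R' w'. w' = w \<and> agree {4, 7, 8, 9, 10, 11} R R' \<and>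
     R' 8 = R 8 * 2 ^ i + x * R y \<and> k \<le> 12 * i) R w"
  using R i
proof (induction i arbitrary: R x)
  case 0
  then show ?case by simp
next
  case (Suc i)
  \<comment> \<open>\<open>a\<close> is the digit of weight \<open>2 ^ i\<close>, and
    \<open>x'\<close> below is what remains of \<open>x\<close>.\<close>
  define a where "a = (if 2 ^ i \<le> x then 1 else 0 :: nat)"
  define x' where "x' = x - a * 2 ^ i"
  have x: "x = a * 2 ^ i + x'" "x' < 2 ^ i"
    using Suc.prems(4) by (auto simp: a_def x'_def)
  define A where "A = 2 * R 8 + a * R y"
  have A: "A * 2 ^ i + x' * R y = R 8 * 2 ^ Suc i + x * R y"
    unfolding A_def by (subst x(1)) (simp add: algebra_simps)
  have pow: "(2::nat) ^ Suc i \<le> 2 ^ b"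
    using Suc.prems(9) by (intro power_increasing) auto
  have "A * 1 \<le> A * 2 ^ i"
    by (intro mult_left_mono) auto
  then have Ab: "A < 2 ^ b"
    using A Suc.prems(5) by linarith
  then have bounds: "2 * R 8 < 2 ^ b" "R 8 < 2 ^ b" "2 * R 8 + a * R y < 2 ^ b"
    by (auto simp: A_def)
  have "3 * b + 30 < 2 ^ b"
    using b by (induction b rule: dec_induct) auto
  then have addr: "3 * i + 30 < 2 ^ b" "Suc i < 2 ^ b" "i < 2 ^ b" "1 < (2::nat) ^ b"
    using Suc.prems(9) by linarith+
  have xb: "x < 2 ^ b" "2 ^ i < (2::nat) ^ b"
    using Suc.prems(4,9) pow power_strict_increasing[of i b "2::nat"] by auto
  let ?P = "\<lambda>k R' w'. k \<le> 11 \<and> w' = w \<and> R' 9 = i \<and> R' 7 = x' \<and> R' 8 = A \<and>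
    agree {4, 7, 8, 9, 10, 11} R R' \<and> (\<forall>j<i. R' (3 * j + 30) = 2 ^ j)"
  define R' where "R' = R(9 := i, 11 := 3 * i + 30, 10 := 2 ^ i, 8 := A, 7 := x', 4 := 2 ^ i - x)"
  have table: "R (3 * i + 30) = 2 ^ i"
    using Suc.prems(8) by simp
  have "R' y = R y"
    using y by (simp add: R'_def)
  let ?S = "R(9 := i, 11 := 3 * i + 30, 4 := 30, 10 := 2 ^ i, 8 := R 8 + R 8, 4 := 2 ^ i - x)"
  have S: "?S 4 = 2 ^ i - x" "?S 7 = x" "?S 8 = 2 * R 8" "?S 10 = 2 ^ i" "?S y = R y"
    using y Suc.prems(3) by simp_all
  have "wp b (IfZ 4 (Atom (Sub 7 7 10) ;; Atom (Add 8 8 y))) (\<lambda>k R'' w'. k \<le> 3 \<and> w' = w \<and> R'' = R') ?S w"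
  proof (rule wp_IfZ, goal_cases)
    case 3
    then have "?S = R'"
      by (auto simp: fun_eq_iff R'_def A_def x'_def a_def Suc.prems(3))
    then show ?case
      by simp
  next
    case 4
    then have "2 ^ i \<le> x"
      unfolding S by simp
    then have "?S(7 := ?S 7 - ?S 10, 8 := ?S 8 + ?S y) = R'"
      unfolding S by (auto simp: fun_eq_iff R'_def A_def x'_def a_def)
    then show ?case
      using y b S bounds xb Suc.prems(7) by (intro wp_Seq wp_Sub wp_Add) simp_all
  next
    case 2
    then show ?case
      using xb(2) unfolding S by linarith
  qed (use b in auto)
  then have "wp b (mul_body y) (\<lambda>k R'' w'. k \<le> 11 \<and> w' = w \<and> R'' = R') R w"
    unfolding mul_body_def using b addr xb bounds table Suc.prems(1,3,6)
    by (intro wp_Seq wp_table_addr wp_Sub wp_Load wp_Add) (auto elim!: wp_conseq)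
  moreover have "?P k R' w" if "k \<le> 11" for k
    using that Suc.prems(8) by (auto simp: R'_def agree_def table_address_def)
  ultimately have "wp b (mul_body y) ?P R w"
    by (elim wp_conseq) auto
  then show ?case
  proof (intro wp_Rep, elim wp_conseq, goal_cases)
    case (1 k R' w')
    note P = this
    have fr: "R' y = R y" "R' 3 = 1"
      using P y Suc.prems by (auto simp: agree_def table_address_def)
    show ?case
    proof (cases "i = 0")
      case True
      then show ?thesis
        using P A x by auto
    next
      case False
      have "wp b (Rep (mul_body y) 9) (\<lambda>k R'' w'. w' = w \<and> agree {4, 7, 8, 9, 10, 11} R' R'' \<and>
          R'' 8 = R' 8 * 2 ^ i + x' * R' y \<and> k \<le> 12 * i) R' w"
        using P False x Suc.prems(5,7,9) fr A by (intro Suc.IH) auto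
      then show ?thesis
        using P False addr A fr by (auto elim!: wp_conseq simp: agree_def)
    qed
  qed (use b in auto)
qed

text \<open>Only the first factor is scanned, so callers put the shorter one there. A table of
  \<open>m\<close> powers leads to at most \<open>22 * m + 5\<close> instructions, where
  \<open>m\<close> is at most the number of digits plus one.\<close>

lemma wp_mul:
  assumes b: "8 \<le> b" and R: "R 3 = 1" "R 2 = 0"
    and x: "R x < 2 ^ (b - 2)" and y: "y \<notin> {4, 7, 8, 9, 10, 11}" "\<not> table_address y" "R y < 2 ^ b"
    and xy: "R x * R y < 2 ^ b"
  shows "wp b (mul d x y) (\<lambda>k R' w'. w' = w \<and> agree {d, 4, 7, 8, 9, 10, 11} R R' \<and>
     R' d = R x * R y \<and> k \<le> 30 * (floorlog 2 (R x) + 1)) R w"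
proof -
  have pow: "(1::nat) < 2 ^ b" "R x < 2 ^ b"
    using b one_less_power[of "2::nat" b] order_less_le_trans[OF x, of "2 ^ b"] by auto
  have fl: "floorlog 2 (R x) \<le> b - 2"
    using x by (simp add: floorlog_le_iff)
  let ?R = "R(7 := R x, 8 := 0, 9 := 0, 10 := 1)"
  have "wp b (mul_loops d y)
    (\<lambda>k R' w'. w' = w \<and> agree {d, 4, 7, 8, 9, 10, 11} R R' \<and>
     R' d = R x * R y \<and> k + 4 \<le> 30 * (floorlog 2 (R x) + 1)) ?R w"
    unfolding mul_loops_def
  proof (rule wp_Seq_conseq[OF wp_fill[where i = 0 and X = "R x"]], goal_cases)
    case (9 k R' w')
    then obtain m where m: "R' 9 = m" "0 < m" "R x < 2 ^ m" "m \<le> floorlog 2 (R x) + 1"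
      "\<forall>j<m. R' (3 * j + 30) = 2 ^ j" "k \<le> 10 * m" and fr: "agree {4, 9, 10, 11} ?R R'" "w' = w"
      by auto
    have R': "R' 7 = R x" "R' 8 = 0" "R' 3 = 1" "R' 2 = 0" "R' y = R y"
      using fr y R by (auto simp: agree_def table_address_def)
    have "wp b (Rep (mul_body y) 9) (\<lambda>k R'' w'. w' = w \<and> agree {4, 7, 8, 9, 10, 11} R' R'' \<and>
     R'' 8 = R' 8 * 2 ^ m + R x * R' y \<and> k \<le> 12 * m) R' w'"
      unfolding fr(2)
      using R' m y xy b fl by (intro wp_mul_loop) auto
    then show ?case
    proof (rule wp_Seq_conseq, goal_cases)
      case (1 l R'' w'')
      then have "R'' 8 = R x * R y" "R'' 2 = 0"
        using R' by (auto simp: agree_def table_address_def)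
      then show ?case
        using 1 m fr xy b by (intro wp_Add) (auto simp: agree_def)
    qed
  qed (use b x R in auto)
  then show ?thesis
    unfolding mul_def using R b pow by (intro wp_Seq wp_Add wp_Const) (auto elim!: wp_conseq)
qed

section \<open>Frame conditions and skipping of lists\<close>

lemma not_table_address [simp]:
  "r < 30 \<Longrightarrow> \<not> table_address r" "\<not> table_address (3 * v + 31)" "\<not> table_address (3 * v + 32)"
proof -
  have "3 * v + 31 = 3 * (v + 10) + 1" "3 * v + 32 = 3 * (v + 10) + 2"
    by simp_all
  then have "(3 * v + 31) mod 3 = 1" "(3 * v + 32) mod 3 = 2"
    by presburger+
  then show "\<not> table_address (3 * v + 31)" "\<not> table_address (3 * v + 32)"
    by (auto simp: table_address_def)
qed (simp add: table_address_def)

lemma less_power_mono: "x < 2 ^ i \<Longrightarrow> i \<le> k \<Longrightarrow> x < (2::nat) ^ k"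
  by (erule order_less_le_trans) (rule power_increasing, simp_all)

lemma agreeD: "agree S R R' \<Longrightarrow> r \<notin> S \<Longrightarrow> \<not> table_address r \<Longrightarrow> R' r = R r"
  by (simp add: agree_def)

lemma agree_trans: "agree S R R' \<Longrightarrow> agree T R' R'' \<Longrightarrow> S \<union> T \<subseteq> U \<Longrightarrow> agree U R R''"
  unfolding agree_def by (metis UnI1 UnI2 subsetD)

lemma agree_upd: "agree S R R' \<Longrightarrow> insert r S \<subseteq> U \<Longrightarrow> agree U R (R'(r := x))"
  by (auto simp: agree_def)

lemma agree_refl: "agree S R R"
  by (simp add: agree_def)

lemma wp_read_nat_agree:
  assumes "8 \<le> b" "x \<notin> {3, 4, 5, 6}" "n < 2 ^ b" "R 3 = 1"
  shows "wp b (read_nat x) (\<lambda>k R' w'. w' = w \<and> R' x = n \<and> agree {x, 4, 5, 6} R R' \<and>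
    k \<le> 5 * length (enc_nat n)) R (enc_nat n @ w)"
  using assms by (intro wp_conseq[OF wp_read_nat]) (auto simp: agree_def)

definition skip_nats :: "nat \<Rightarrow> nat \<Rightarrow> com" where
  "skip_nats t x = enc_loop t (read_nat x)"

lemma length_enc_list: "length (enc_list e xs) = (\<Sum>x\<leftarrow>xs. length (e x) + 1) + 1"
  by (simp add: enc_list_def length_concat comp_def add.commute)

lemma wp_skip_nats:
  assumes b: "8 \<le> b" and t: "t < 30" "t \<notin> {3, 4, 5, 6, x}" "x \<notin> {3, 4, 5, 6}"
    and ns: "\<And>n. n \<in> set ns \<Longrightarrow> n < 2 ^ b" and R: "R 3 = 1"
  shows "wp b (skip_nats t x) (\<lambda>k R' w'. w' = w \<and> agree {t, x, 4, 5, 6} R R' \<and>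
    k \<le> 5 * length (enc_list enc_nat ns)) R (enc_list enc_nat ns @ w)"
proof -
  let ?I = "\<lambda>_ :: nat list. agree {t, x, 4, 5, 6} R"
  have "wp b (enc_loop t (read_nat x)) (\<lambda>k R' w'. w' = w \<and> ?I ns R' \<and>
    k + (\<lambda>_. 0) R' \<le> (\<lambda>_. 0) R + (\<Sum>n\<leftarrow>ns. 5 * length (enc_nat n) + 4) + 4) R (enc_list enc_nat ns @ w)"
  proof (rule wp_enc_loop, goal_cases)
    case (5 ys R')
    then show ?case
      using agreeD[OF 5, of 3] R t by simp
  next
    case (6 ys R' u v)
    then show ?case
      by (auto simp: agree_def)
  next
    case (8 ys n zs R' w)
    have "R' 3 = 1"
      using agreeD[OF 8(2), of 3] R t by simp
    then have "wp b (read_nat x) (\<lambda>k R'' w'. w' = w \<and> R'' x = n \<and> agree {x, 4, 5, 6} R' R'' \<and>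
       k \<le> 5 * length (enc_nat n)) R' (enc_nat n @ w)"
      using 8(1) ns t by (intro wp_read_nat_agree b) auto
    then show ?case
    proof (rule wp_conseq, goal_cases)
      case (1 k R'' w')
      moreover have "agree {t, x, 4, 5, 6} R R''"
        using 1 8(2) by (auto simp: agree_def)
      moreover have "R'' t = 1"
        using agreeD[of "{x, 4, 5, 6}" R' R'' t] 1 8(3) t by simp
      ultimately show ?case
        by simp
    qed
  qed (use b t in \<open>simp_all add: agree_refl\<close>)
  moreover have "(\<Sum>n\<leftarrow>ns. 5 * length (enc_nat n) + 4) + 4 \<le> 5 * length (enc_list enc_nat ns)"
    by (induction ns) (auto simp: length_enc_list)
  ultimately show ?thesis
    unfolding skip_nats_def by (elim wp_conseq) auto
qed

section \<open>Processing one entry\<close>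

text \<open>The members of the parent set are consumed but not kept: only the score of an entry
  enters the optimum.\<close>

definition read_entry :: com where
  "read_entry = read_nat 14 ;; skip_nats 13 15 ;; read_nat 16 ;; read_nat 17"

lemma wp_read_entry:
  assumes b: "8 \<le> b" and R: "R 3 = 1" and v: "v < 2 ^ b" and ps: "\<And>u. u \<in> set ps \<Longrightarrow> u < 2 ^ b"
    and pq: "p < 2 ^ b" "q < 2 ^ b"
  shows "wp b read_entry (\<lambda>k R' w'. w' = w \<and> R' 14 = v \<and> R' 16 = p \<and> R' 17 = q \<and>
    agree {4, 5, 6, 13, 14, 15, 16, 17} R R' \<and> k \<le> 5 * length (enc_entry (v, ps, p, q)))
    R (enc_entry (v, ps, p, q) @ w)"
  unfolding read_entry_def enc_entry.simps append_assoc
proof (rule wp_Seq_conseq[OF wp_read_nat_agree], goal_cases)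
  case (5 k1 R1 w1)
  then have R1: "R1 14 = v" "agree {14, 4, 5, 6} R R1"
    and w1: "w1 = enc_list enc_nat ps @ enc_nat p @ enc_nat q @ w" "k1 \<le> 5 * length (enc_nat v)"
    by simp_all
  have one1: "R1 3 = 1"
    using agreeD[OF R1(2), of 3] R by simp
  show ?case
    unfolding w1
  proof (rule wp_Seq_conseq[OF wp_skip_nats], goal_cases)
    case (7 k2 R2 w2)
    then have w2: "w2 = enc_nat p @ enc_nat q @ w" "k2 \<le> 5 * length (enc_list enc_nat ps)"
      and fr: "agree {13, 15, 4, 5, 6} R1 R2"
      by simp_all
    have R2: "agree {4, 5, 6, 13, 14, 15} R R2"
      by (rule agree_trans[OF R1(2) fr]) auto
    have S2: "R2 14 = v" "R2 3 = 1"
      using agreeD[OF fr, of 14] agreeD[OF fr, of 3] R1 one1 by simp_all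
    show ?case
      unfolding w2
    proof (rule wp_Seq_conseq[OF wp_read_nat_agree], goal_cases)
      case (5 k3 R3 w3)
      then have w3: "w3 = enc_nat q @ w" "k3 \<le> 5 * length (enc_nat p)"
        and R3: "R3 16 = p" and fr: "agree {16, 4, 5, 6} R2 R3"
        by simp_all
      have R3': "agree {4, 5, 6, 13, 14, 15, 16} R R3"
        by (rule agree_trans[OF R2 fr]) auto
      have S3: "R3 14 = v" "R3 3 = 1"
        using agreeD[OF fr, of 14] agreeD[OF fr, of 3] S2 by simp_all
      show ?case
        unfolding w3
      proof (rule wp_conseq[OF wp_read_nat_agree], goal_cases)
        case (5 k4 R4 w4)
        then have fr: "agree {17, 4, 5, 6} R3 R4"
          by simp
        have "agree {4, 5, 6, 13, 14, 15, 16, 17} R R4"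
          by (rule agree_trans[OF R3' fr]) auto
        then show ?case
          using 5 R3 S3 w1 w2 w3 agreeD[OF fr, of 14] agreeD[OF fr, of 16] by simp
      qed (use S3 pq b in simp_all)
    qed (use S2 pq b in simp_all)
  qed (use one1 ps b in simp_all)
qed (use R v b in simp_all)

text \<open>An untouched pair reads \<open>0 / 0\<close>. Turning it into \<open>0 / 1\<close> lets
  the first entry of a node go through the same cross multiplication, and keeps \<open>Q\<close>
  from being multiplied by 0.\<close>

definition look_up :: com where
  "look_up = Atom (Add 26 14 14) ;; Atom (Add 26 26 14) ;; Atom (Const 4 31) ;; Atom (Add 26 26 4) ;;
     Atom (Add 27 26 3) ;; Atom (Load 18 26) ;; Atom (Load 19 27) ;; IfZ 19 (Atom (Const 19 1))"

lemma wp_look_up: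
  assumes b: "8 \<le> b" and R: "R 3 = 1" "R 14 = v" "3 * v + 32 < 2 ^ b"
    "R (3 * v + 31) < 2 ^ b" "R (3 * v + 32) < 2 ^ b"
  shows "wp b look_up (\<lambda>k R' w'. w' = w \<and> R' 18 = R (3 * v + 31) \<and>
    R' 19 = (if R (3 * v + 32) = 0 then 1 else R (3 * v + 32)) \<and>
    R' 26 = 3 * v + 31 \<and> R' 27 = 3 * v + 32 \<and> agree {4, 18, 19, 26, 27} R R' \<and> k \<le> 9) R w"
proof -
  have eq: "v + v + v + 31 = 3 * v + 31" "v + v + v + 32 = 3 * v + 32" "32 + 3 * v = 3 * v + 32"
    by simp_all
  have "(1::nat) < 2 ^ b"
    using b by (intro one_less_power) auto
  then show ?thesis
    unfolding look_up_def using b R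
    by (intro wp_Seq wp_Add wp_Const wp_Load wp_IfZ) (simp_all add: eq agree_def)
qed

text \<open>This computes \<open>P / Q + D / E\<close> with \<open>E = q * q'\<close> over the
  denominator \<open>E * Q\<close>. The loops scan \<open>q\<close>, \<open>E\<close> and
  \<open>D\<close>; the long \<open>P\<close> and \<open>Q\<close> are always second
  factors.\<close>

definition update :: com where
  "update = mul 23 17 19 ;; mul 20 23 24 ;; mul 21 22 25 ;; Atom (Add 24 20 21) ;; mul 25 23 25 ;;
     Atom (Store 26 16) ;; Atom (Store 27 17)"

lemma wp_update:
  assumes b: "8 \<le> b" and R: "R 3 = 1" "R 2 = 0" "R 16 = p" "R 17 = q" "R 19 = q'" "R 22 = D" "R 24 = P" "R 25 = Q"
    "R 26 = 3 * v + 31" "R 27 = 3 * v + 32" and E: "E = q * q'"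
    and bounds: "p < 2 ^ b" "q < 2 ^ (b - 2)" "q' < 2 ^ b" "D < 2 ^ (b - 2)" "P < 2 ^ b" "Q < 2 ^ b"
      "E < 2 ^ (b - 2)" "E * P < 2 ^ b" "D * Q < 2 ^ b" "E * Q < 2 ^ b" "3 * v + 32 < 2 ^ b"
  shows "wp b update (\<lambda>k R' w'. w' = w \<and> R' 24 = E * P + D * Q \<and> R' 25 = E * Q \<and>
    R' (3 * v + 31) = p \<and> R' (3 * v + 32) = q \<and>
    agree {4, 7, 8, 9, 10, 11, 20, 21, 23, 24, 25, 3 * v + 31, 3 * v + 32} R R' \<and>
    k \<le> 30 * (floorlog 2 q + 2 * floorlog 2 E + floorlog 2 D + 4) + 3) R w"
  unfolding update_def
proof (rule wp_Seq_conseq[OF wp_mul], goal_cases)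
  case (9 k1 R1 w1)
  have b2: "(2::nat) ^ (b - 2) \<le> 2 ^ b"
    by (intro power_increasing) auto
  from 9 have R1: "agree {4, 7, 8, 9, 10, 11, 23} R R1" "R1 23 = E"
    and k1: "w1 = w" "k1 \<le> 30 * (floorlog 2 q + 1)"
    using R E by (simp_all add: insert_commute)
  have S1: "R1 3 = 1" "R1 2 = 0" "R1 24 = P" "R1 25 = Q"
    using R by (simp_all add: agreeD[OF R1(1)])
  show ?case
  proof (rule wp_Seq_conseq[OF wp_mul], goal_cases)
    case (9 k2 R2 w2)
    then have fr: "agree {20, 4, 7, 8, 9, 10, 11} R1 R2" and R2: "R2 20 = E * P"
      and k2: "w2 = w" "k2 \<le> 30 * (floorlog 2 E + 1)"
      using R1 S1 k1 by simp_all
    have R2': "agree {4, 7, 8, 9, 10, 11, 20, 23} R R2"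
      by (rule agree_trans[OF R1(1) fr]) auto
    have S2: "R2 3 = 1" "R2 2 = 0" "R2 24 = P" "R2 25 = Q" "R2 22 = D" "R2 23 = E"
      using R R1(2) by (simp_all add: agreeD[OF R2'] agreeD[OF fr, of 23])
    show ?case
    proof (rule wp_Seq_conseq[OF wp_mul], goal_cases)
      case (9 k3 R3 w3)
      then have fr: "agree {21, 4, 7, 8, 9, 10, 11} R2 R3" and R3: "R3 21 = D * Q"
        and k3: "w3 = w" "k3 \<le> 30 * (floorlog 2 D + 1)"
        using S2 k2 by simp_all
      have R3': "agree {4, 7, 8, 9, 10, 11, 20, 21, 23} R R3"
        by (rule agree_trans[OF R2' fr]) auto
      have S3: "R3 3 = 1" "R3 2 = 0" "R3 25 = Q" "R3 20 = E * P" "R3 23 = E"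
        using R R2 S2 by (simp_all add: agreeD[OF R3'] agreeD[OF fr, of 20] agreeD[OF fr, of 23])
      let ?R = "R3(24 := E * P + D * Q)"
      have "wp b (mul 25 23 25) (\<lambda>k R' w'. w' = w3 \<and> agree {25, 4, 7, 8, 9, 10, 11} ?R R' \<and>
          R' 25 = ?R 23 * ?R 25 \<and> k \<le> 30 * (floorlog 2 (?R 23) + 1)) ?R w3"
        using b S3 bounds by (intro wp_mul) simp_all
      then have "wp b (mul 25 23 25 ;; Atom (Store 26 16) ;; Atom (Store 27 17))
       (\<lambda>k R' w'. w' = w \<and> R' 24 = E * P + D * Q \<and> R' 25 = E * Q \<and>
        R' (3 * v + 31) = p \<and> R' (3 * v + 32) = q \<and>
        agree {4, 7, 8, 9, 10, 11, 20, 21, 23, 24, 25, 3 * v + 31, 3 * v + 32} R R' \<and>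
        k \<le> 30 * (floorlog 2 E + 1) + 2) ?R w3"
      proof (rule wp_Seq_conseq, goal_cases)
        case (1 k4 R4 w4)
        then have fr: "agree {25, 4, 7, 8, 9, 10, 11} ?R R4" and R4: "R4 25 = E * Q"
          and k4: "w4 = w" "k4 \<le> 30 * (floorlog 2 E + 1)"
          using S3 k3 by simp_all
        have R3'': "agree {4, 7, 8, 9, 10, 11, 20, 21, 23, 24} R ?R"
          by (rule agree_upd[OF R3']) auto
        have R4': "agree {4, 7, 8, 9, 10, 11, 20, 21, 23, 24, 25} R R4"
          by (rule agree_trans[OF R3'' fr]) auto
        have S4: "R4 26 = 3 * v + 31" "R4 27 = 3 * v + 32" "R4 16 = p" "R4 17 = q" "R4 24 = E * P + D * Q"
          using R by (simp_all add: agreeD[OF R4'] agreeD[OF fr, of 24])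
        have "agree {4, 7, 8, 9, 10, 11, 20, 21, 23, 24, 25, 3 * v + 31, 3 * v + 32} R
            (R4(3 * v + 31 := p, 3 * v + 32 := q))"
          by (rule agree_upd[OF agree_upd[OF R4' order_refl]]) auto
        then show ?case
          using b bounds b2 R4 S4 k4 order_less_le_trans[OF bounds(2) b2]
            by (intro wp_Seq wp_Store) simp_all
      qed
      then have "wp b (mul 25 23 25 ;; Atom (Store 26 16) ;; Atom (Store 27 17))
       (\<lambda>k R' w'. w' = w \<and> R' 24 = E * P + D * Q \<and> R' 25 = E * Q \<and>
        R' (3 * v + 31) = p \<and> R' (3 * v + 32) = q \<and>
        agree {4, 7, 8, 9, 10, 11, 20, 21, 23, 24, 25, 3 * v + 31, 3 * v + 32} R R' \<and>
        k1 + (k2 + (k3 + (1 + k))) \<le> 30 * (floorlog 2 q + 2 * floorlog 2 E + floorlog 2 D + 4) + 3) ?R w3"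
        using k1 k2 k3 by (elim wp_conseq) simp
      then show ?case
        using b bounds R3 S3 by (intro wp_Seq[of b "Atom _"] wp_Add) simp_all
    qed (use S2 b bounds in simp_all)
  qed (use S1 R1 b bounds in simp_all)
next
  case 8
  have "E < 2 ^ b"
    using bounds(7) by (rule less_power_mono) simp
  then show ?case
    using R E by simp
qed (use R E b bounds in simp_all)

text \<open>The comparison scans the new \<open>p\<close> and \<open>q\<close>, never the stored
  pair, so a rejected entry costs only its own length. The length of \<open>q'\<close> matters,
  through \<open>E\<close> and \<open>D\<close>, only in \<open>update\<close>, which discards
  \<open>q'\<close>.\<close>

definition process_entry :: com where
  "process_entry = read_entry ;; look_up ;; mul 20 16 19 ;; mul 21 17 18 ;;
     Atom (Sub 22 20 21) ;; Atom (Sub 4 3 22) ;; IfZ 4 update"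

lemma floorlog_mult: "floorlog 2 (x * y) \<le> floorlog 2 x + floorlog 2 (y::nat)"
proof -
  have "x < 2 ^ floorlog 2 x" "y < 2 ^ floorlog 2 y"
    using floorlog_le_iff[of 2 x "floorlog 2 x"] floorlog_le_iff[of 2 y "floorlog 2 y"] by auto
  then have "x * y < 2 ^ (floorlog 2 x + floorlog 2 y)"
    unfolding power_add by (intro mult_strict_mono') auto
  then show ?thesis
    by (simp add: floorlog_le_iff)
qed

lemma less_power_mult: "x < 2 ^ i \<Longrightarrow> y < 2 ^ j \<Longrightarrow> i + j \<le> k \<Longrightarrow> x * y < (2::nat) ^ k"
proof -
  assume "x < 2 ^ i" "y < 2 ^ j" "i + j \<le> k"
  then have "x * y < 2 ^ (i + j)"
    unfolding power_add by (intro mult_strict_mono') auto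
  also have "\<dots> \<le> 2 ^ k"
    using \<open>i + j \<le> k\<close> by (intro power_increasing) auto
  finally show ?thesis .
qed

text \<open>The variables \<open>p\<close>, \<open>q\<close>, \<open>r\<close>, \<open>E\<close>,
  \<open>D\<close> are digit counts here. The coefficient 90 is 30 * (2 + 1): the digits of the old
  denominator recur in \<open>E\<close>, scanned twice, and in \<open>D\<close>, scanned
  once.\<close>

lemma process_entry_steps:
  fixes L :: nat
  assumes "k1 \<le> 5 * L" "k2 \<le> 9" "k3 \<le> 30 * (p + 1)" "k4 \<le> 30 * (q + 1)" "2 * p + 2 * q + 4 \<le> L"
    "E \<le> q + r + 1" "D \<le> p + r + 1"
  shows "k1 + k2 + k3 + k4 + 3 \<le> 105 * L"
    "k1 + k2 + k3 + k4 + 30 * (q + 2 * E + D + 4) + 6 \<le> 105 * L + 90 * r"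
  using assms by simp_all

lemma wp_process_entry:
  fixes R :: "nat \<Rightarrow> nat" and v p q :: nat
  defines "r \<equiv> R (3 * v + 32)"
  defines "p' \<equiv> R (3 * v + 31)" and "q' \<equiv> if r = 0 then 1 else r"
  defines "E \<equiv> q * q'" and "D \<equiv> p * q' - q * p'"
  assumes m: "2 \<le> m" and b: "b = 6 * m + 20"
    and R: "R 3 = 1" "R 2 = 0" "R 24 = P" "R 25 = Q"
    and bounds: "v < 2 ^ m" "\<And>u. u \<in> set ps \<Longrightarrow> u < 2 ^ m" "p < 2 ^ m" "q < 2 ^ m" "p' < 2 ^ m" "r < 2 ^ m"
      "P < 2 ^ (4 * m)" "Q < 2 ^ (4 * m)"
  shows "wp b process_entry (\<lambda>k R' w'. w' = w \<and>
    agree ({..<30} - {2, 3, 12, 24, 25} \<union> (if D = 0 then {} else {24, 25, 3 * v + 31, 3 * v + 32})) R R' \<and>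
    k \<le> 105 * length (enc_entry (v, ps, p, q)) + (if D = 0 then 0 else 90 * floorlog 2 r) \<and>
    (D \<noteq> 0 \<longrightarrow> R' 24 = E * P + D * Q \<and> R' 25 = E * Q \<and> R' (3 * v + 31) = p \<and> R' (3 * v + 32) = q))
    R (enc_entry (v, ps, p, q) @ w)"
proof -
  let ?L = "length (enc_entry (v, ps, p, q))"
  let ?S = "{..<30} - {2, 3, 12, 24, 25} :: nat set"
  have b8: "8 \<le> b"
    using b by simp
  have q': "q' < 2 ^ m"
    using bounds(6) m one_less_power[of "2::nat" m] by (simp add: q'_def)
  have pq': "p * q' < 2 ^ (2 * m)" "q * p' < 2 ^ (2 * m)"
    using bounds q' by (auto intro: less_power_mult)
  have D: "D < 2 ^ (2 * m)"
    using pq' by (simp add: D_def)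
  have E: "E < 2 ^ (2 * m)"
    unfolding E_def using bounds q' by (auto intro: less_power_mult)
  \<comment> \<open>A factor of \<open>2 * m\<close> bits meets one of \<open>4 * m\<close> bits;
    this dictates the \<open>6 * m\<close> in \<open>b\<close>, whose additive 20 is slack.\<close>
  have prods: "E * P < 2 ^ (6 * m)" "D * Q < 2 ^ (6 * m)" "E * Q < 2 ^ (6 * m)"
    using D E bounds by (auto intro: less_power_mult)
  have lift: "x < 2 ^ m \<Longrightarrow> x < 2 ^ (b - 2)" "x < 2 ^ m \<Longrightarrow> x < 2 ^ b"
    "x < 2 ^ (2 * m) \<Longrightarrow> x < 2 ^ (b - 2)" "x < 2 ^ (2 * m) \<Longrightarrow> x < 2 ^ b"
    "x < 2 ^ (4 * m) \<Longrightarrow> x < 2 ^ b" "x < 2 ^ (6 * m) \<Longrightarrow> x < 2 ^ b" for x :: nat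
    unfolding b by (erule less_power_mono; simp)+
  have addr: "3 * v + 32 < 2 ^ b"
  proof -
    have "32 < (2::nat) ^ 6"
      by simp
    also have "(2::nat) ^ 6 \<le> 2 ^ (m + 8)"
      by (intro power_increasing) auto
    finally have "3 * v + 32 < 4 * 2 ^ (m + 8)"
      using bounds(1) power_increasing[of m "m + 8" "2::nat"] by linarith
    also have "\<dots> = 2 ^ (m + 10)"
      by (simp add: power_add)
    finally show ?thesis
      unfolding b by (rule less_power_mono) simp
  qed
  \<comment> \<open>The 1 pays for the default \<open>q' = 1\<close>, which has one digit while
    \<open>floorlog 2 0 = 0\<close>.\<close>
  have fl_q': "floorlog 2 q' \<le> floorlog 2 r + 1"
    by (auto simp: q'_def compute_floorlog)
  have "floorlog 2 D \<le> floorlog 2 (p * q')"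
    by (rule floorlog_mono) (simp add: D_def)
  then have fl: "floorlog 2 E \<le> floorlog 2 q + floorlog 2 r + 1" "floorlog 2 D \<le> floorlog 2 p + floorlog 2 r + 1"
    using fl_q' floorlog_mult[of q q'] floorlog_mult[of p q'] unfolding E_def by linarith+
  have L: "2 * floorlog 2 p + 2 * floorlog 2 q + 4 \<le> ?L"
    by (simp add: length_enc_nat length_enc_list)
  have "wp b read_entry (\<lambda>k R' w'. w' = w \<and> R' 14 = v \<and> R' 16 = p \<and> R' 17 = q \<and>
    agree {4, 5, 6, 13, 14, 15, 16, 17} R R' \<and> k \<le> 5 * ?L) R (enc_entry (v, ps, p, q) @ w)"
    using bounds R by (intro wp_read_entry b8 lift(2)) auto
  then show ?thesis
    unfolding process_entry_def
  proof (rule wp_Seq_conseq, goal_cases)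
    case (1 k1 R1 w1)
    then have R1: "R1 14 = v" "R1 16 = p" "R1 17 = q" "w1 = w" "k1 \<le> 5 * ?L"
      and fr: "agree {4, 5, 6, 13, 14, 15, 16, 17} R R1"
      by simp_all
    have fr1: "agree ?S R R1"
      by (rule agree_trans[OF fr agree_refl[of "{}"]]) auto
    have S1: "R1 3 = 1" "R1 2 = 0" "R1 24 = P" "R1 25 = Q" "R1 (3 * v + 31) = p'" "R1 (3 * v + 32) = r"
      by (simp_all add: agreeD[OF fr1] R p'_def r_def)
    have "wp b look_up (\<lambda>k R' w'. w' = w1 \<and> R' 18 = R1 (3 * v + 31) \<and>
        R' 19 = (if R1 (3 * v + 32) = 0 then 1 else R1 (3 * v + 32)) \<and>
        R' 26 = 3 * v + 31 \<and> R' 27 = 3 * v + 32 \<and> agree {4, 18, 19, 26, 27} R1 R' \<and> k \<le> 9) R1 w1"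
      using R1 S1 bounds addr b8 by (intro wp_look_up) (auto intro: lift)
    then show ?case
    proof (rule wp_Seq_conseq, goal_cases)
      case (1 k2 R2 w2)
      then have R2: "R2 18 = p'" "R2 19 = q'" "R2 26 = 3 * v + 31" "R2 27 = 3 * v + 32" "w2 = w" "k2 \<le> 9"
        and fr: "agree {4, 18, 19, 26, 27} R1 R2"
        using S1 R1 by (simp_all add: q'_def)
      have fr2: "agree ?S R R2"
        by (rule agree_trans[OF fr1 fr]) auto
      have S2: "R2 3 = 1" "R2 2 = 0" "R2 24 = P" "R2 25 = Q" "R2 16 = p" "R2 17 = q"
        by (simp_all add: agreeD[OF fr] S1 R1)
      show ?case
      proof (rule wp_Seq_conseq[OF wp_mul], goal_cases)
        case (9 k3 R3 w3)
        then have R3: "R3 20 = p * q'" "w3 = w" "k3 \<le> 30 * (floorlog 2 p + 1)"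
          and fr: "agree {20, 4, 7, 8, 9, 10, 11} R2 R3"
          using S2 R2 by simp_all
        have fr3: "agree ?S R R3"
          by (rule agree_trans[OF fr2 fr]) auto
        have S3: "R3 3 = 1" "R3 2 = 0" "R3 24 = P" "R3 25 = Q" "R3 16 = p" "R3 17 = q"
          "R3 18 = p'" "R3 19 = q'" "R3 26 = 3 * v + 31" "R3 27 = 3 * v + 32"
          by (simp_all add: agreeD[OF fr] S2 R2)
        show ?case
        proof (rule wp_Seq_conseq[OF wp_mul], goal_cases)
          case (9 k4 R4 w4)
          then have R4: "R4 21 = q * p'" "w4 = w" "k4 \<le> 30 * (floorlog 2 q + 1)"
            and fr: "agree {21, 4, 7, 8, 9, 10, 11} R3 R4"
            using S3 R3 by simp_all
          have fr4: "agree ?S R R4"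
            by (rule agree_trans[OF fr3 fr]) auto
          have S4: "R4 3 = 1" "R4 2 = 0" "R4 24 = P" "R4 25 = Q" "R4 16 = p" "R4 17 = q" "R4 20 = p * q'"
            "R4 18 = p'" "R4 19 = q'" "R4 26 = 3 * v + 31" "R4 27 = 3 * v + 32"
            by (simp_all add: agreeD[OF fr] S3 R3)
          let ?R = "R4(22 := D, 4 := 1 - D)"
          have frR: "agree ?S R ?R"
            by (rule agree_upd[OF agree_upd[OF fr4 order_refl]]) auto
          have steps: "k1 + k2 + k3 + k4 + 3 \<le> 105 * ?L"
            "k1 + k2 + k3 + k4 + 30 * (floorlog 2 q + 2 * floorlog 2 E + floorlog 2 D + 4) + 6
              \<le> 105 * ?L + 90 * floorlog 2 r"
            using process_entry_steps[OF R1(5) R2(6) R3(3) R4(3) L fl] by simp_all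
          have one: "1 < (2::nat) ^ b"
            using b by (intro one_less_power) auto
          have "wp b (IfZ 4 update) (\<lambda>k R' w'. w' = w \<and>
            agree (?S \<union> (if D = 0 then {} else {24, 25, 3 * v + 31, 3 * v + 32})) R R' \<and>
            k1 + (k2 + (k3 + (k4 + (1 + (1 + k))))) \<le> 105 * ?L + (if D = 0 then 0 else 90 * floorlog 2 r) \<and>
            (D \<noteq> 0 \<longrightarrow> R' 24 = E * P + D * Q \<and> R' 25 = E * Q \<and> R' (3 * v + 31) = p \<and> R' (3 * v + 32) = q))
            ?R w4"
          proof (rule wp_IfZ, goal_cases)
            case 3
            then have "D = 0"
              by simp
            then show ?case
              using frR R4 steps by simp
          next
            case 4
            then have D0: "D \<noteq> 0"
              by simp
            have "wp b update (\<lambda>k R' w'. w' = w4 \<and> R' 24 = E * P + D * Q \<and> R' 25 = E * Q \<and>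
              R' (3 * v + 31) = p \<and> R' (3 * v + 32) = q \<and>
              agree {4, 7, 8, 9, 10, 11, 20, 21, 23, 24, 25, 3 * v + 31, 3 * v + 32} ?R R' \<and>
              k \<le> 30 * (floorlog 2 q + 2 * floorlog 2 E + floorlog 2 D + 4) + 3) ?R w4"
              using S4 bounds q' D E prods addr
              by (intro wp_update[where q' = q'] b8) (simp_all add: lift E_def)
            then show ?case
            proof (rule wp_conseq, goal_cases)
              case (1 k R' w')
              then have fr: "agree {4, 7, 8, 9, 10, 11, 20, 21, 23, 24, 25, 3 * v + 31, 3 * v + 32} ?R R'"
                by simp
              have "agree (?S \<union> {24, 25, 3 * v + 31, 3 * v + 32}) R R'"
                by (rule agree_trans[OF frR fr]) auto
              then show ?case
                using 1 D0 R4 steps by simp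
            qed
          qed (use one b8 in auto)
          then show ?case
            using b8 S4 R4 D one pq' by (intro wp_Seq[of b "Atom _"] wp_Sub) (simp_all add: D_def lift)
        qed (use S3 R3 b8 bounds pq' in \<open>simp_all add: lift\<close>)
      qed (use S2 R2 b8 bounds pq' q' in \<open>simp_all add: lift\<close>)
    qed
  qed
qed

section \<open>The optimum and the loop over the entries\<close>

text \<open>The maximum starts at 0 because the empty parent set is always available and has a
  nonnegative score, listed or not.\<close>

definition best :: "entry list \<Rightarrow> nat \<Rightarrow> real" where
  "best es v = fold (\<lambda>(u, ps, p, q) x. if u = v then max (real p / real q) x else x) es 0"

lemma best_simps [simp]:
  "best [] v = 0"
  "best (es @ [(u, ps, p, q)]) v = (if u = v then max (real p / real q) (best es v) else best es v)"
  by (simp_all add: best_def)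

lemma best_nonneg: "0 \<le> best es v"
  by (induction es rule: rev_induct) (auto simp: max_def)

lemma best_ge: "(v, ps, p, q) \<in> set es \<Longrightarrow> real p / real q \<le> best es v"
  by (induction es rule: rev_induct) (auto simp: le_max_iff_disj split: if_splits)

lemma best_attained:
  "best es v = 0 \<or> (\<exists>ps p q. (v, ps, p, q) \<in> set es \<and> best es v = real p / real q)"
proof (induction es rule: rev_induct)
  case (snoc e es)
  obtain u ps p q where "e = (u, ps, p, q)"
    by (cases e)
  with snoc show ?case
    by (auto simp: max_def)
qed simp

text \<open>The arcs from independently chosen best parent sets all lie in the super-structure and
  inherit its acyclicity, so the sum is attained. It is an upper bound node by node for every
  dag.\<close>

lemma bnsl_yes_iff:
  assumes N: "finite N" and f: "local_score N f" and acyclic: "acyclic (directed_super_structure N f)"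
    and rep: "nonzero_representation N f es"
  shows "bnsl_yes (N, f, s) \<longleftrightarrow> s \<le> (\<Sum>v\<in>N. best es v)"
proof -
  have rep_eq: "(\<lambda>(v, ps, p, q). (v, set ps, real p / real q)) ` set es =
      {(v, P, f v P) | v P. v \<in> N \<and> P \<subseteq> N - {v} \<and> f v P > 0}"
    using rep by (simp add: nonzero_representation_def)
  have le_best: "f v P \<le> best es v" if "v \<in> N" "P \<subseteq> N - {v}" for v P
  proof (cases "f v P > 0")
    case True
    then have "(v, P, f v P) \<in> (\<lambda>(v, ps, p, q). (v, set ps, real p / real q)) ` set es"
      unfolding rep_eq using that by blast
    then show ?thesis
      using best_ge by fastforce
  next
    case False
    then show ?thesis
      using best_nonneg[of es v] by linarith
  qed
  have "\<exists>P. P \<in> potential_parent_sets N f v \<and> best es v \<le> f v P" if "v \<in> N" for v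
    using best_attained[of es v]
  proof
    assume "best es v = 0"
    then show ?thesis
      using f that by (intro exI[of _ "{}"]) (auto simp: potential_parent_sets_def local_score_def)
  next
    assume "\<exists>ps p q. (v, ps, p, q) \<in> set es \<and> best es v = real p / real q"
    then obtain ps p q where e: "(v, ps, p, q) \<in> set es" "best es v = real p / real q"
      by blast
    then have "(v, set ps, best es v) \<in> (\<lambda>(v, ps, p, q). (v, set ps, real p / real q)) ` set es"
      by force
    then show ?thesis
      unfolding rep_eq by (auto simp: potential_parent_sets_def)
  qed
  then obtain P where P: "\<And>v. v \<in> N \<Longrightarrow> P v \<in> potential_parent_sets N f v"
    "\<And>v. v \<in> N \<Longrightarrow> best es v \<le> f v (P v)"
    by metis
  have PN: "P v \<subseteq> N" if "v \<in> N" for v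
    using P(1)[OF that] by (auto simp: potential_parent_sets_def)
  define D where "D = {(u, v). v \<in> N \<and> u \<in> P v}"
  have "D \<subseteq> directed_super_structure N f"
    using P(1) PN by (auto simp: D_def directed_super_structure_def)
  then have dag: "dag_on N D"
    using acyclic_subset[OF acyclic] PN by (auto simp: dag_on_def D_def)
  have "parents D v = P v" if "v \<in> N" for v
    using that by (auto simp: parents_def D_def)
  then have "(\<Sum>v\<in>N. best es v) \<le> dag_score N f D"
    unfolding dag_score_def by (intro sum_mono) (simp add: P)
  moreover have "dag_score N f D' \<le> (\<Sum>v\<in>N. best es v)" if D': "dag_on N D'" for D'
    unfolding dag_score_def
  proof (intro sum_mono le_best)
    fix v
    \<comment> \<open>A loop at \<open>v\<close> would be a cycle.\<close>
    show "parents D' v \<subseteq> N - {v}"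
      using D' by (auto simp: dag_on_def parents_def acyclic_def)
  qed
  ultimately show ?thesis
    using dag by force
qed

section \<open>Loop invariant and amortized analysis\<close>

text \<open>Division by 0 yields 0, so an untouched pair counts as score 0; the clause on zero
  denominators makes the default of \<open>look_up\<close> consistent with this. In the length bound
  an accepted \<open>q\<close> adds its digits both to \<open>Q\<close> and to the storage, hence
  the factor 2, while a replaced denominator merely moves from the storage into \<open>Q\<close>;
  the 1 is the length of the initial \<open>Q = 1\<close>. The last clause bounds the value of
  \<open>P / Q\<close> independently of denominators, so that the length of \<open>P\<close> follows
  from that of \<open>Q\<close>.\<close>

definition loop_inv :: "nat \<Rightarrow> nat set \<Rightarrow> entry list \<Rightarrow> (nat \<Rightarrow> nat) \<Rightarrow> bool" where
  "loop_inv m N es R \<longleftrightarrow> R 3 = 1 \<and> R 2 = 0 \<and>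
     (\<forall>v. real (R (3 * v + 31)) / real (R (3 * v + 32)) = best es v \<and>
        (R (3 * v + 32) = 0 \<longrightarrow> R (3 * v + 31) = 0) \<and> R (3 * v + 31) < 2 ^ m \<and> R (3 * v + 32) < 2 ^ m) \<and>
     0 < R 25 \<and> real (R 24) / real (R 25) = (\<Sum>v\<in>N. best es v) \<and>
     floorlog 2 (R 25) + (\<Sum>v\<in>N. floorlog 2 (R (3 * v + 32))) \<le> 1 + 2 * (\<Sum>(v, ps, p, q)\<leftarrow>es. floorlog 2 q) \<and>
     R 24 \<le> R 25 * 2 ^ (\<Sum>(v, ps, p, q)\<leftarrow>es. floorlog 2 p + 1)"

text \<open>The factor 90 is the price that an update pays per digit of the denominator it
  replaces.\<close>

definition potential :: "nat set \<Rightarrow> (nat \<Rightarrow> nat) \<Rightarrow> nat" where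
  "potential N R = 90 * (\<Sum>v\<in>N. floorlog 2 (R (3 * v + 32)))"

lemma less_power_floorlog: "x < 2 ^ floorlog 2 (x::nat)"
  using floorlog_le_iff[of 2 x "floorlog 2 x"] by simp

lemma loop_inv_step:
  fixes R R' :: "nat \<Rightarrow> nat" and v p q :: nat
  defines "r \<equiv> R (3 * v + 32)"
  defines "p' \<equiv> R (3 * v + 31)" and "q' \<equiv> if r = 0 then 1 else r"
  defines "E \<equiv> q * q'" and "D \<equiv> p * q' - q * p'"
  assumes N: "finite N" "v \<in> N" and pq: "0 < q" "p < 2 ^ m" "q < 2 ^ m"
    and inv: "loop_inv m N es R"
    and fr: "agree ({..<30} - {2, 3, 12, 24, 25} \<union> (if D = 0 then {} else {24, 25, 3 * v + 31, 3 * v + 32})) R R'"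
    and upd: "D \<noteq> 0 \<longrightarrow> R' 24 = E * R 24 + D * R 25 \<and> R' 25 = E * R 25 \<and>
      R' (3 * v + 31) = p \<and> R' (3 * v + 32) = q"
  shows "loop_inv m N (es @ [(v, ps, p, q)]) R'"
    and "potential N R' + (if D = 0 then 0 else 90 * floorlog 2 r) \<le> potential N R + 90 * floorlog 2 q"
proof -
  have q'0: "0 < q'"
    by (simp add: q'_def)
  have old: "best es v = real p' / real q'"
    using inv unfolding loop_inv_def p'_def q'_def r_def by (auto dest: spec[of _ v])
  \<comment> \<open>Both denominators are positive, so this is cross multiplication with a truncated
    difference.\<close>
  have D_iff: "D = 0 \<longleftrightarrow> real p / real q \<le> best es v"
  proof -
    have "D = 0 \<longleftrightarrow> real (p * q') \<le> real (q * p')"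
      unfolding D_def of_nat_le_iff by simp
    also have "\<dots> \<longleftrightarrow> real p / real q \<le> best es v"
      unfolding old using pq(1) q'0 by (simp add: field_simps)
    finally show ?thesis .
  qed
  have "loop_inv m N (es @ [(v, ps, p, q)]) R' \<and>
     potential N R' + (if D = 0 then 0 else 90 * floorlog 2 r) \<le> potential N R + 90 * floorlog 2 q"
  proof (cases "D = 0")
    case True
    then have best: "best (es @ [(v, ps, p, q)]) u = best es u" for u
      using D_iff by (auto simp: max_absorb2)
    have same: "R' 2 = R 2" "R' 3 = R 3" "R' 24 = R 24" "R' 25 = R 25"
      "\<And>u. R' (3 * u + 31) = R (3 * u + 31)" "\<And>u. R' (3 * u + 32) = R (3 * u + 32)"
      using True by (simp_all add: agreeD[OF fr])
    have "R 25 * 2 ^ (\<Sum>(v, ps, p, q)\<leftarrow>es. floorlog 2 p + 1) \<le>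
        R 25 * 2 ^ (\<Sum>(v, ps, p, q)\<leftarrow>es @ [(v, ps, p, q)]. floorlog 2 p + 1)"
      by (intro mult_left_mono power_increasing) auto
    moreover have "R 24 \<le> R 25 * 2 ^ (\<Sum>(v, ps, p, q)\<leftarrow>es. floorlog 2 p + 1)"
      using inv by (simp add: loop_inv_def)
    ultimately have "R 24 \<le> R 25 * 2 ^ (\<Sum>(v, ps, p, q)\<leftarrow>es @ [(v, ps, p, q)]. floorlog 2 p + 1)"
      by (rule order_trans[rotated])
    with inv True show ?thesis
      unfolding loop_inv_def potential_def best same by simp
  next
    case False
    let ?P = "R 24" and ?Q = "R 25"
    let ?es = "es @ [(v, ps, p, q)]"
    have new: "R' 24 = E * ?P + D * ?Q" "R' 25 = E * ?Q" "R' (3 * v + 31) = p" "R' (3 * v + 32) = q"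
      using upd False by auto
    have same: "R' 2 = R 2" "R' 3 = R 3"
      "\<And>u. u \<noteq> v \<Longrightarrow> R' (3 * u + 31) = R (3 * u + 31)" "\<And>u. u \<noteq> v \<Longrightarrow> R' (3 * u + 32) = R (3 * u + 32)"
    proof -
      show "R' 2 = R 2" "R' 3 = R 3"
        by (simp_all add: agreeD[OF fr])
      fix u assume "u \<noteq> v"
      moreover have "3 * u + 31 \<noteq> 3 * v + 32" "3 * u + 32 \<noteq> 3 * v + 31"
        by presburger+
      ultimately show "R' (3 * u + 31) = R (3 * u + 31)" "R' (3 * u + 32) = R (3 * u + 32)"
        by (auto intro!: agreeD[OF fr] split: if_splits)
    qed
    have best_v: "best ?es v = real p / real q" and best_u: "u \<noteq> v \<Longrightarrow> best ?es u = best es u" for u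
      using False D_iff by auto
    have E0: "0 < E" and Q0: "0 < ?Q"
      using pq(1) q'0 inv by (simp_all add: E_def loop_inv_def)
    \<comment> \<open>A nonzero \<open>D\<close> is not truncated, so \<open>D / E\<close> is
      exactly the gain at \<open>v\<close>.\<close>
    have "q * p' \<le> p * q'"
      using False by (simp add: D_def)
    then have D_real: "real D = real p * real q' - real q * real p'"
      by (simp add: D_def of_nat_diff)
    have "(\<Sum>u\<in>N. best ?es u) = (\<Sum>u\<in>N. best es u) - best es v + best ?es v"
      using N best_u by (simp add: sum.remove[of N v])
    also have "\<dots> = real ?P / real ?Q + real D / real E"
      unfolding best_v old D_real E_def using inv pq(1) q'0
      by (simp add: loop_inv_def field_simps)
    also have "\<dots> = real (R' 24) / real (R' 25)"
      using E0 Q0 unfolding new by (simp add: field_simps)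
    finally have total: "real (R' 24) / real (R' 25) = (\<Sum>u\<in>N. best ?es u)"
      by simp
    have fl_sum: "(\<Sum>u\<in>N. floorlog 2 (R' (3 * u + 32))) + floorlog 2 r =
        (\<Sum>u\<in>N. floorlog 2 (R (3 * u + 32))) + floorlog 2 q"
      using N same(4) new(4) by (simp add: sum.remove[of N v] r_def)
    \<comment> \<open>The digits of \<open>r\<close> that \<open>Q\<close> gains are those that the
      storage loses by \<open>fl_sum\<close>. Treating \<open>q' = 1\<close> apart keeps the digit
      of this default out of the bound.\<close>
    have "E * ?Q = (q * ?Q) * (if r = 0 then 1 else r)"
      by (simp add: E_def q'_def)
    then have "floorlog 2 (E * ?Q) \<le> floorlog 2 q + floorlog 2 ?Q + floorlog 2 r"
      using floorlog_mult[of q ?Q] floorlog_mult[of "q * ?Q" r] by (auto simp: mult_ac split: if_splits)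
    then have size: "floorlog 2 (R' 25) + (\<Sum>u\<in>N. floorlog 2 (R' (3 * u + 32))) \<le>
        1 + 2 * (\<Sum>(v, ps, p, q)\<leftarrow>?es. floorlog 2 q)"
      using inv fl_sum unfolding loop_inv_def new by simp
    let ?s = "\<Sum>(v, ps, p, q)\<leftarrow>es. floorlog 2 p + 1"
    \<comment> \<open>Since \<open>q \<ge> 1\<close>, the gain \<open>D / E\<close> is at most
      \<open>p\<close>. The spare digit in \<open>floorlog 2 p + 1\<close> later absorbs the sum of
      two powers of two.\<close>
    have "D \<le> p * q'"
      by (simp add: D_def)
    also have "\<dots> \<le> p * E"
      using pq(1) by (simp add: E_def)
    finally have "D * ?Q \<le> p * E * ?Q"
      by (rule mult_right_mono) simp
    moreover have "E * ?P \<le> E * (?Q * 2 ^ ?s)"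
      using inv by (intro mult_left_mono) (simp_all add: loop_inv_def)
    ultimately have "E * ?P + D * ?Q \<le> E * (?Q * 2 ^ ?s) + p * E * ?Q"
      by (rule add_mono[rotated])
    also have "\<dots> = E * ?Q * (2 ^ ?s + p)"
      by (simp add: algebra_simps)
    finally have "R' 24 \<le> E * ?Q * (2 ^ ?s + p)"
      unfolding new .
    also have "2 ^ ?s + p \<le> 2 ^ (?s + (floorlog 2 p + 1))"
    proof -
      have "(2::nat) ^ ?s \<le> 2 ^ (?s + floorlog 2 p)" "(2::nat) ^ floorlog 2 p \<le> 2 ^ (?s + floorlog 2 p)"
        by (intro power_increasing; simp)+
      then have "2 ^ ?s + p \<le> 2 * 2 ^ (?s + floorlog 2 p)"
        using less_power_floorlog[of p] by linarith
      then show ?thesis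
        by simp
    qed
    finally have "R' 24 \<le> R' 25 * 2 ^ (\<Sum>(v, ps, p, q)\<leftarrow>?es. floorlog 2 p + 1)"
      unfolding new by simp
    moreover have "real (R' (3 * u + 31)) / real (R' (3 * u + 32)) = best ?es u \<and>
        (R' (3 * u + 32) = 0 \<longrightarrow> R' (3 * u + 31) = 0) \<and> R' (3 * u + 31) < 2 ^ m \<and> R' (3 * u + 32) < 2 ^ m" for u
    proof (cases "u = v")
      case True
      then show ?thesis
        using new best_v pq by simp
    next
      case False
      then show ?thesis
        using inv unfolding loop_inv_def same(3,4)[OF False] best_u[OF False] by blast
    qed
    moreover have "0 < R' 25"
      using E0 Q0 new by simp
    ultimately have "loop_inv m N ?es R'"
      using inv total size unfolding loop_inv_def same by blast
    then show ?thesis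
      using False fl_sum by (simp add: potential_def)
  qed
  then show "loop_inv m N (es @ [(v, ps, p, q)]) R'"
    and "potential N R' + (if D = 0 then 0 else 90 * floorlog 2 r) \<le> potential N R + 90 * floorlog 2 q"
    by blast+
qed

lemma length_enc_entry_bounds:
  "2 * floorlog 2 v + 2 * floorlog 2 p + 2 * floorlog 2 q + 4 \<le> length (enc_entry (v, ps, p, q))"
  "u \<in> set ps \<Longrightarrow> floorlog 2 u \<le> length (enc_entry (v, ps, p, q))"
proof -
  assume "u \<in> set ps"
  then have "length (enc_nat u) + 1 \<le> (\<Sum>u\<leftarrow>ps. length (enc_nat u) + 1)"
    by (intro member_le_sum_list) auto
  then show "floorlog 2 u \<le> length (enc_entry (v, ps, p, q))"
    by (simp add: length_enc_nat length_enc_list)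
qed (simp add: length_enc_nat length_enc_list)

lemma floorlog_score_le_length:
  "2 * (case e of (v, ps, p, q) \<Rightarrow> floorlog 2 q) \<le> length (enc_entry e)"
  "(case e of (v, ps, p, q) \<Rightarrow> floorlog 2 p + 1) \<le> length (enc_entry e)"
proof -
  obtain v ps p q where e: "e = (v, ps, p, q)"
    by (cases e)
  show "2 * (case e of (v, ps, p, q) \<Rightarrow> floorlog 2 q) \<le> length (enc_entry e)"
    "(case e of (v, ps, p, q) \<Rightarrow> floorlog 2 p + 1) \<le> length (enc_entry e)"
    unfolding e prod.case using length_enc_entry_bounds(1)[of v p q ps] by linarith+
qed

text \<open>Digits take two bits, so the doubled lengths in the invariant fit into the encoding and
  \<open>Q\<close> has at most \<open>m + 1\<close> digits; the value bound \<open>2 ^ m\<close>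
  gives \<open>P\<close> at most \<open>m\<close> more.\<close>

lemma loop_inv_bounds:
  assumes m: "2 \<le> m" and len: "(\<Sum>e\<leftarrow>es. length (enc_entry e)) \<le> m" and inv: "loop_inv m N es R"
  shows "R 24 < 2 ^ (4 * m)" "R 25 < 2 ^ (4 * m)"
proof -
  have "2 * (\<Sum>(v, ps, p, q)\<leftarrow>es. floorlog 2 q) \<le> (\<Sum>e\<leftarrow>es. length (enc_entry e))"
    unfolding sum_list_const_mult[symmetric] by (intro sum_list_mono floorlog_score_le_length)
  then have "floorlog 2 (R 25) \<le> 1 + m"
    using inv len unfolding loop_inv_def by linarith
  then have Q: "R 25 < 2 ^ (1 + m)"
    using less_power_mono[OF less_power_floorlog] by blast
  have "(\<Sum>(v, ps, p, q)\<leftarrow>es. floorlog 2 p + 1) \<le> (\<Sum>e\<leftarrow>es. length (enc_entry e))"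
    by (intro sum_list_mono floorlog_score_le_length)
  then have "(2::nat) ^ (\<Sum>(v, ps, p, q)\<leftarrow>es. floorlog 2 p + 1) \<le> 2 ^ m"
    using len by (intro power_increasing) auto
  then have "R 25 * 2 ^ (\<Sum>(v, ps, p, q)\<leftarrow>es. floorlog 2 p + 1) \<le> R 25 * 2 ^ m"
    by (rule mult_left_mono) simp
  then have "R 24 \<le> R 25 * 2 ^ m"
    using inv unfolding loop_inv_def by linarith
  also have "\<dots> < 2 ^ (1 + m) * 2 ^ m"
    using Q by simp
  also have "\<dots> = 2 ^ (1 + m + m)"
    by (simp add: power_add)
  finally show "R 24 < 2 ^ (4 * m)"
    by (rule less_power_mono) (use m in simp)
  show "R 25 < 2 ^ (4 * m)"
    by (rule less_power_mono[OF Q]) (use m in simp)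
qed

lemma sum_length_le_enc_list: "(\<Sum>x\<leftarrow>xs. length (e x)) \<le> length (enc_list e xs)"
  by (induction xs) (auto simp: enc_list_def)

lemma wp_entries:
  assumes m: "2 \<le> m" and b: "b = 6 * m + 20" and len: "length (enc_list enc_entry es) \<le> m"
    and N: "finite N" and es: "\<And>v ps p q. (v, ps, p, q) \<in> set es \<Longrightarrow> v \<in> N \<and> 0 < q"
    and R: "loop_inv m N [] R" "potential N R = 0"
  shows "wp b (enc_loop 12 process_entry) (\<lambda>k R' w'. w' = w \<and> loop_inv m N es R' \<and>
     k \<le> 150 * length (enc_list enc_entry es)) R (enc_list enc_entry es @ w)"
proof -
  let ?g = "\<lambda>e. 150 * length (enc_entry e)"
  have sum_len: "(\<Sum>e\<leftarrow>es. length (enc_entry e)) \<le> m"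
    using sum_length_le_enc_list[of enc_entry es] len by simp
  have "wp b (enc_loop 12 process_entry) (\<lambda>k R' w'. w' = w \<and> loop_inv m N es R' \<and>
     k + potential N R' \<le> potential N R + (\<Sum>e\<leftarrow>es. ?g e + 4) + 4) R (enc_list enc_entry es @ w)"
  proof (rule wp_enc_loop, goal_cases)
    case (8 ys e zs R w)
    obtain v ps p q where e: "e = (v, ps, p, q)"
      by (cases e)
    let ?L = "length (enc_entry (v, ps, p, q))"
    have split: "(\<Sum>e\<leftarrow>ys. length (enc_entry e)) + ?L \<le> m"
      using sum_len unfolding 8(1) e by simp
    have small: "x < 2 ^ m" if "floorlog 2 x \<le> ?L" for x
      using less_power_floorlog[of x] less_power_mono that split by fastforce
    note bounds = length_enc_entry_bounds[where v = v and ps = ps and p = p and q = q]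
    have vpq: "v < 2 ^ m" "p < 2 ^ m" "q < 2 ^ m" "\<And>u. u \<in> set ps \<Longrightarrow> u < 2 ^ m"
      using bounds by (auto intro!: small)
    have v: "v \<in> N" "0 < q"
      using es[of v ps p q] unfolding 8(1) e by auto
    have PQ: "R 24 < 2 ^ (4 * m)" "R 25 < 2 ^ (4 * m)"
      using loop_inv_bounds[OF m _ 8(2)] split by auto
    have inv: "R 3 = 1" "R 2 = 0" "R (3 * v + 31) < 2 ^ m" "R (3 * v + 32) < 2 ^ m"
      using 8(2) by (auto simp: loop_inv_def)
    show ?case
      unfolding e
    proof (rule wp_conseq[OF wp_process_entry[OF m b inv(1,2) HOL.refl HOL.refl vpq(1) vpq(4) vpq(2,3) inv(3,4) PQ]], goal_cases)
      case (2 k R' w')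
      note post = this
      note step = loop_inv_step(1)[where ps = ps, OF N v vpq(2,3) 8(2) post[THEN conjunct2, THEN conjunct1]
        post[THEN conjunct2, THEN conjunct2, THEN conjunct2]]
        loop_inv_step(2)[OF N v vpq(2,3) 8(2) post[THEN conjunct2, THEN conjunct1]
        post[THEN conjunct2, THEN conjunct2, THEN conjunct2]]
      have "R' 12 = R 12"
        using agreeD[OF post[THEN conjunct2, THEN conjunct1], of 12] by simp
      \<comment> \<open>The potential grows by 90 per digit of \<open>q\<close>, hence by 45 per bit
        of its encoding; 105 + 45 gives the 150.\<close>
      moreover have "90 * floorlog 2 q \<le> 45 * ?L"
        using bounds(1) by linarith
      ultimately show ?case
        using post step 8(3) by simp
    qed
  qed (use R b in \<open>auto simp: loop_inv_def potential_def\<close>)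
  moreover have "(\<Sum>e\<leftarrow>es. ?g e + 4) + 4 \<le> 150 * length (enc_list enc_entry es)"
    by (induction es) (auto simp: length_enc_list)
  ultimately show ?thesis
    using R(2) by (elim wp_conseq) auto
qed

section \<open>The complete program and its running time\<close>

definition bnsl_program :: com where
  "bnsl_program = Atom (Const 3 1) ;; Atom (Const 25 1) ;; skip_nats 12 14 ;; enc_loop 12 process_entry ;;
     read_nat 16 ;; read_nat 17 ;; mul 20 16 25 ;; mul 21 17 24 ;; Atom (Add 21 21 3) ;; Atom (Sub 0 21 20)"

lemma wp_bnsl_program:
  assumes b: "b = 6 * length w + 20"
    and w: "w = enc_list enc_nat ns @ enc_list enc_entry es @ enc_nat p @ enc_nat q"
    and es: "\<And>v ps p q. (v, ps, p, q) \<in> set es \<Longrightarrow> v \<in> set ns \<and> 0 < q" and q: "0 < q"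
  shows "wp b bnsl_program (\<lambda>k R w'. k \<le> 200 * length w \<and>
    (0 < R 0 \<longleftrightarrow> real p / real q \<le> (\<Sum>v\<in>set ns. best es v))) (\<lambda>_. 0) w"
proof -
  define m where "m = length w"
  let ?N = "set ns"
  have len: "length (enc_list enc_nat ns) + length (enc_list enc_entry es) +
      2 * floorlog 2 p + 2 * floorlog 2 q + 2 = m"
    by (simp add: m_def w length_enc_nat)
  have ns_pos: "0 < length (enc_list enc_nat ns)"
    by (simp add: length_enc_list)
  have m: "2 \<le> m" "1 \<le> m" "length (enc_list enc_entry es) \<le> m"
    using len by linarith+
  have b: "b = 6 * m + 20" "8 \<le> b" "1 \<le> b"
    using b by (simp_all add: m_def)
  have one: "1 < (2::nat) ^ b"
    using b by (intro one_less_power) auto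
  have small: "x < 2 ^ m" if "floorlog 2 x \<le> m" for x
    using less_power_floorlog that by (rule less_power_mono)
  have pq: "p < 2 ^ m" "q < 2 ^ m"
    using len by (intro small; linarith)+
  have lift: "x < 2 ^ m \<Longrightarrow> x < 2 ^ (b - 2)" "x < 2 ^ m \<Longrightarrow> x < 2 ^ b"
    "x < 2 ^ (4 * m) \<Longrightarrow> x < 2 ^ b" "x < 2 ^ (5 * m) \<Longrightarrow> x < 2 ^ (5 * m + 1)" "x < 2 ^ (5 * m + 1) \<Longrightarrow> x < 2 ^ b"
    for x :: nat
    unfolding b by (erule less_power_mono; simp)+
  have ns: "n < 2 ^ b" if "n \<in> set ns" for n
  proof -
    have "length (enc_nat n) + 1 \<le> (\<Sum>n\<leftarrow>ns. length (enc_nat n) + 1)"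
      using that by (intro member_le_sum_list) auto
    then show ?thesis
      using len by (intro lift(2) small) (simp add: length_enc_nat length_enc_list)
  qed
  let ?R0 = "(\<lambda>_. 0)(3 := 1, 25 := 1) :: nat \<Rightarrow> nat"
  have "wp b (skip_nats 12 14) (\<lambda>k R' w'. w' = enc_list enc_entry es @ enc_nat p @ enc_nat q \<and>
      agree {12, 14, 4, 5, 6} ?R0 R' \<and> k \<le> 5 * length (enc_list enc_nat ns)) ?R0 w"
    unfolding w using ns by (intro wp_skip_nats b(2)) auto
  then have "wp b (skip_nats 12 14 ;; enc_loop 12 process_entry ;;
     read_nat 16 ;; read_nat 17 ;; mul 20 16 25 ;; mul 21 17 24 ;; Atom (Add 21 21 3) ;; Atom (Sub 0 21 20))
     (\<lambda>k R w'. k + 2 \<le> 200 * m \<and> (0 < R 0 \<longleftrightarrow> real p / real q \<le> (\<Sum>v\<in>?N. best es v))) ?R0 w"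
  proof (rule wp_Seq_conseq, goal_cases)
    case (1 k1 R1 w1)
    then have w1: "w1 = enc_list enc_entry es @ enc_nat p @ enc_nat q" "k1 \<le> 5 * length (enc_list enc_nat ns)"
      and fr: "agree {12, 14, 4, 5, 6} ?R0 R1"
      by simp_all
    have R1: "R1 2 = 0" "R1 3 = 1" "R1 24 = 0" "R1 25 = 1" "R1 (3 * v + 31) = 0" "R1 (3 * v + 32) = 0" for v
      by (simp_all add: agreeD[OF fr])
    have inv1: "loop_inv m ?N [] R1" "potential ?N R1 = 0"
      by (simp_all add: loop_inv_def potential_def R1 compute_floorlog)
    show ?case
      unfolding w1
    proof (rule wp_Seq_conseq[OF wp_entries[OF m(1) b(1) m(3) finite_set es inv1]], goal_cases)
      case (2 k2 R2 w2)
      then have w2: "w2 = enc_nat p @ enc_nat q" "k2 \<le> 150 * length (enc_list enc_entry es)"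
        and inv2: "loop_inv m ?N es R2"
        by simp_all
      define P Q where "P = R2 24" and "Q = R2 25"
      have R2: "R2 2 = 0" "R2 3 = 1" and Q0: "0 < Q" and total: "real P / real Q = (\<Sum>v\<in>?N. best es v)"
        using inv2 by (simp_all add: loop_inv_def P_def Q_def)
      have PQ: "P < 2 ^ (4 * m)" "Q < 2 ^ (4 * m)"
        using loop_inv_bounds[OF m(1) order_trans[OF sum_length_le_enc_list m(3)] inv2] by (simp_all add: P_def Q_def)
      have prods: "p * Q < 2 ^ (5 * m)" "q * P < 2 ^ (5 * m)"
        using pq PQ by (auto intro: less_power_mult)
      show ?case
        unfolding w2
      proof (rule wp_Seq_conseq[OF wp_read_nat_agree], goal_cases)
        case (5 k3 R3 w3)
        then have w3: "w3 = enc_nat q @ []" "k3 \<le> 5 * length (enc_nat p)" and fr: "agree {16, 4, 5, 6} R2 R3"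
          and R3p: "R3 16 = p"
          by simp_all
        have R3: "R3 2 = 0" "R3 3 = 1" "R3 24 = P" "R3 25 = Q"
          by (simp_all add: agreeD[OF fr] R2 P_def Q_def)
        show ?case
          unfolding w3
        proof (rule wp_Seq_conseq[OF wp_read_nat_agree], goal_cases)
          case (5 k4 R4 w4)
          then have w4: "k4 \<le> 5 * length (enc_nat q)" and fr: "agree {17, 4, 5, 6} R3 R4"
            and R4q: "R4 17 = q"
            by simp_all
          have R4: "R4 2 = 0" "R4 3 = 1" "R4 24 = P" "R4 25 = Q" "R4 16 = p"
            by (simp_all add: agreeD[OF fr] R3 R3p)
          show ?case
          proof (rule wp_Seq_conseq[OF wp_mul], goal_cases)
            case (9 k5 R5 w5)
            then have k5: "k5 \<le> 30 * (floorlog 2 p + 1)" and fr: "agree {20, 4, 7, 8, 9, 10, 11} R4 R5"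
              and R5p: "R5 20 = p * Q"
              using R4 by simp_all
            have R5: "R5 2 = 0" "R5 3 = 1" "R5 24 = P" "R5 17 = q"
              by (simp_all add: agreeD[OF fr] R4 R4q)
            show ?case
            proof (rule wp_Seq_conseq[OF wp_mul], goal_cases)
              case (9 k6 R6 w6)
              then have k6: "k6 \<le> 30 * (floorlog 2 q + 1)" and fr: "agree {21, 4, 7, 8, 9, 10, 11} R5 R6"
                and R6q: "R6 21 = q * P"
                using R5 by simp_all
              have R6: "R6 3 = 1" "R6 20 = p * Q"
                by (simp_all add: agreeD[OF fr] R5 R5p)
              have "k1 + k2 + k3 + k4 + k5 + k6 + 4 \<le> 200 * m"
                using w1(2) w2(2) w3(2) w4 k5 k6 len ns_pos by (simp add: length_enc_nat)
              \<comment> \<open>The added 1 makes the truncated difference positive also when the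
                threshold is met with equality.\<close>
              moreover have "0 < q * P + 1 - p * Q \<longleftrightarrow> real p / real q \<le> real P / real Q"
              proof -
                have "0 < q * P + 1 - p * Q \<longleftrightarrow> real (p * Q) \<le> real (q * P)"
                  unfolding of_nat_le_iff by auto
                also have "\<dots> \<longleftrightarrow> real p / real q \<le> real P / real Q"
                  using q Q0 by (simp add: field_simps)
                finally show ?thesis .
              qed
              moreover have "q * P + 1 < 2 ^ b"
                using prods(2) by (intro lift(5)) simp
              moreover have "p * Q < 2 ^ b" "q * P < 2 ^ b"
                using prods by (auto intro!: lift(5) lift(4))
              ultimately show ?case
                using b one R6 R6q total by (intro wp_Seq wp_Add wp_Sub) simp_all
            qed (use R5 b(2) pq PQ prods in \<open>simp_all add: lift\<close>)
          qed (use R4 R4q b(2) pq PQ prods in \<open>simp_all add: lift\<close>)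
        qed (use R3 b(2) pq in \<open>simp_all add: lift\<close>)
      qed (use R2 b(2) pq in \<open>simp_all add: lift\<close>)
    qed
  qed
  then show ?thesis
    unfolding bnsl_program_def m_def[symmetric] using b one
    by (intro wp_Seq[of b "Atom _"] wp_Const) simp_all
qed

lemma wp_decides:
  assumes "wp b c (\<lambda>k R w'. k \<le> n \<and> (0 < R 0 \<longleftrightarrow> answer)) (\<lambda>_. 0) w"
  shows "decides_within (compile 0 c) w (n * (2 * b)) answer"
proof -
  obtain k R w' where *: "run (2 * b) c (\<lambda>_. 0) w k R w'" "k \<le> n" "0 < R 0 \<longleftrightarrow> answer"
    using assms unfolding wp_def by blast
  obtain t where t: "t \<le> k * (2 * b)"
    "exec (compile 0 c) (init_config w) t \<lparr>pc = code_size c, reg = R, tape = w'\<rparr>"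
    using exec_compile[OF *(1), of "[]" "[]"] by (auto simp: init_config_def)
  moreover have "k * (2 * b) \<le> n * (2 * b)"
    using *(2) by (rule mult_right_mono) simp
  ultimately show ?thesis
    using *(3) order_trans[OF t(1)] unfolding decides_within_def
    by (intro exI[of _ t] exI[of _ "\<lparr>pc = code_size c, reg = R, tape = w'\<rparr>"]) auto
qed

lemma decides_within_mono: "decides_within M w S answer \<Longrightarrow> S \<le> T \<Longrightarrow> decides_within M w T answer"
  unfolding decides_within_def by (meson order_trans)

theorem corollary2:
  "solvable_in_quadratic_time_on
     {(N, f, s) \<in> bnsl_instances. acyclic (directed_super_structure N f)} encodes bnsl_yes"
  unfolding solvable_in_quadratic_time_on_def
proof (intro exI ballI allI impI)
  fix x w
  assume "x \<in> {(N, f, s) \<in> bnsl_instances. acyclic (directed_super_structure N f)}" and enc: "encodes x w"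
  then obtain N f s where x: "x = (N, f, s)" and N: "finite N" "local_score N f"
      "acyclic (directed_super_structure N f)"
    by (auto simp: bnsl_instances_def)
  obtain ns es p q where ns: "set ns = N" and rep: "nonzero_representation N f es"
    and q: "0 < q" and s: "s = real p / real q"
    and w: "w = enc_list enc_nat ns @ enc_list enc_entry es @ enc_nat p @ enc_nat q"
    using enc unfolding x by auto
  have es: "v \<in> set ns \<and> 0 < q" if "(v, ps, p, q) \<in> set es" for v ps p q
  proof -
    have "(v, set ps, real p / real q) \<in> (\<lambda>(v, ps, p, q). (v, set ps, real p / real q)) ` set es"
      using that by force
    then show ?thesis
      using rep that unfolding nonzero_representation_def ns by auto
  qed
  have "decides_within (compile 0 bnsl_program) w (200 * length w * (2 * (6 * length w + 20)))
      (real p / real q \<le> (\<Sum>v\<in>set ns. best es v))"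
    by (intro wp_decides wp_bnsl_program[OF HOL.refl w es q])
  \<comment> \<open>An encoding is never empty, so 20 is at most \<open>20 * length w\<close>; the
    constant is 200 * 2 * 26.\<close>
  moreover have "200 * length w * (2 * (6 * length w + 20)) \<le> 10400 * (length w)\<^sup>2"
  proof -
    have "1 \<le> length w"
      by (simp add: w enc_list_def)
    then have "6 * length w + 20 \<le> 26 * length w"
      by simp
    then have "200 * length w * (2 * (6 * length w + 20)) \<le> 200 * length w * (2 * (26 * length w))"
      by (intro mult_left_mono) auto
    then show ?thesis
      by (simp add: power2_eq_square)
  qed
  ultimately show "decides_within (compile 0 bnsl_program) w (10400 * (length w)\<^sup>2) (bnsl_yes x)"
    unfolding x bnsl_yes_iff[OF N rep] s ns by (rule decides_within_mono)
qed

end
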